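(* Let $\lambda$ be some positive measure on $\mathcal{X}$ and let $\|\cdot\|_2$ denote the norm in $\mathbb{L}_2(\lambda)$. Let $\{\overline{S}_m\}_{m\in\mathcal{M}}$ be a finite or countable family of linear subspaces of $\mathbb{L}_2(\lambda)$ with respective finite dimensions $\overline{D}_m$ and let $\{\Delta_m\}_{m\in\mathcal{M}}$ be a family of nonnegative weights satisfying $$\sum_{m\in\mathcal{M}}\exp[-\Delta_m]\le\Sigma<+\infty.$$ Let $\boldsymbol{X}$ be a Poisson process on $\mathcal{X}$ with unknown mean measure $\mu=\mu_s+\mu^\perp\in\mathcal{Q}_+(\mathcal{X})$, where $s\in\mathbb{L}_1^+(\lambda)$, $\mu_s=s\cdot\lambda$ and $\mu^\perp$ is orthogonal to $\lambda$. One can build an estimator $\hat\mu=\hat\mu(\boldsymbol{X})=\hat s(\boldsymbol{X})\cdot\lambda\in\mathcal{Q}_\lambda$ (not depending on the unknown $\mu$) satisfying, for all $\mu\in\mathcal{Q}_+(\mathcal{X})$ and $q\ge1$, $$\mathbb{E}_\mu\left[H^q(\mu,\hat\mu)\right]\le C(q)\,[1+\Sigma]\left[\sqrt{\mu^\perp(\mathcal{X})}+\inf_{m\in\mathcal{M}}\left\{\inf_{t\in\overline{S}_m}\left\|\sqrt{s}-t\right\|_2+\sqrt{\overline{D}_m\vee\Delta_m}\right\}\right]^q,$$ with a constant $C(q)$ depending on $q$ only.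
   Context: $(\mathcal{X},\mathcal{E})$ is a measurable space and $\mathcal{Q}_+(\mathcal{X})$ is the set of finite positive measures on it. A Poisson process with mean measure $\mu\in\mathcal{Q}_+(\mathcal{X})$ is a point process $\boldsymbol{X}=\{X_1,\dots,X_N\}$ on $\mathcal{X}$ such that $N$ is Poisson with parameter $\mu(\mathcal{X})$ and, conditionally on $N$, the $X_i$ are i.i.d. with distribution $\mu/\mu(\mathcal{X})$. $\mathbb{E}_\mu$ denotes expectation when $\boldsymbol{X}$ has mean measure $\mu$. An estimator is a measurable function of $\boldsymbol{X}$. For $\mu,\mu'\in\mathcal{Q}_+(\mathcal{X})$, $$H^2(\mu,\mu')=\frac12\int\left(\sqrt{d\mu/d\nu}-\sqrt{d\mu'/d\nu}\right)^2d\nu,$$ where $\nu$ is any measure dominating both $\mu$ and $\mu'$ (the value does not depend on $\nu$), and $H\ge 0$. $\mathbb{L}_1^+(\lambda)$ is the set of nonnegative elements of $\mathbb{L}_1(\lambda)$ and $\mathcal{Q}_\lambda=\{t\cdot\lambda : t\in\mathbb{L}_1^+(\lambda)\}$. $a\vee b=\max(a,b)$.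
   Formalization: The formal theorem assumes a nonempty family with max(D_m, Δ_m) ≥ 1 for all m, excluding zero-dimensional models of weight below 1 (with {0} and L2 of a Dirac mass at weight 0 the claim fails); C(q) is uniform over all measures on a given point type. *)

theory Defs
  imports "HOL-Probability.Probability"
begin

text \<open>
  A measurable space is given by any measure carrying it; only its \<^const>\<open>space\<close> and
  \<^const>\<open>sets\<close> matter then.
\<close>

section \<open>Finite measures\<close>

definition finite_measures :: "'a measure \<Rightarrow> 'a measure set" where
  "finite_measures M = {\<mu>. sets \<mu> = sets M \<and> finite_measure \<mu>}"

definition measure_add :: "'a measure \<Rightarrow> 'a measure \<Rightarrow> 'a measure" where
  "measure_add \<mu> \<nu> = measure_of (space \<mu>) (sets \<mu>) (\<lambda>A. emeasure \<mu> A + emeasure \<nu> A)"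

definition orthogonal_measures :: "'a measure \<Rightarrow> 'a measure \<Rightarrow> bool" where
  "orthogonal_measures \<mu> \<nu> \<longleftrightarrow>
     (\<exists>A\<in>sets \<mu>. emeasure \<mu> A = 0 \<and> emeasure \<nu> (space \<nu> - A) = 0)"

lemma sets_measure_add [simp, measurable_cong]: "sets (measure_add \<mu> \<nu>) = sets \<mu>"
  by (simp add: measure_add_def)

lemma space_measure_add [simp]: "space (measure_add \<mu> \<nu>) = space \<mu>"
  by (simp add: measure_add_def)

lemma emeasure_measure_add:
  assumes "sets \<mu> = sets \<nu>" "A \<in> sets \<mu>"
  shows "emeasure (measure_add \<mu> \<nu>) A = emeasure \<mu> A + emeasure \<nu> A"
  unfolding measure_add_def
proof (rule emeasure_measure_of_sigma)
  show "countably_additive (sets \<mu>) (\<lambda>A. emeasure \<mu> A + emeasure \<nu> A)"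
  proof (rule countably_additiveI)
    fix B :: "nat \<Rightarrow> _" assume "range B \<subseteq> sets \<mu>" "disjoint_family B"
    then show "(\<Sum>i. emeasure \<mu> (B i) + emeasure \<nu> (B i)) =
        emeasure \<mu> (\<Union>i. B i) + emeasure \<nu> (\<Union>i. B i)"
      using assms by (simp add: suminf_add[symmetric] suminf_emeasure)
  qed
qed (use assms(2) sets.sigma_algebra_axioms in \<open>auto simp: positive_def\<close>)

section \<open>Hellinger distance\<close>

text \<open>
  The dominating measure is taken to be the sum of the two arguments;
  \<open>hellinger_dominated\<close> below shows that any other choice gives the same value.
\<close>

definition hellinger_sq :: "'a measure \<Rightarrow> 'a measure \<Rightarrow> real" where
  "hellinger_sq \<mu> \<mu>' =
     (let \<nu> = measure_add \<mu> \<mu>' in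
      1 / 2 * (\<integral>x. (sqrt (enn2real (RN_deriv \<nu> \<mu> x)) - sqrt (enn2real (RN_deriv \<nu> \<mu>' x)))\<^sup>2 \<partial>\<nu>))"

definition hellinger :: "'a measure \<Rightarrow> 'a measure \<Rightarrow> real" where
  "hellinger \<mu> \<mu>' = sqrt (hellinger_sq \<mu> \<mu>')"

lemma density_measure_add_RN_deriv:
  assumes "\<mu> \<in> finite_measures M" "\<mu>' \<in> finite_measures M"
  shows "density (measure_add \<mu> \<mu>') (RN_deriv (measure_add \<mu> \<mu>') \<mu>) = \<mu>"
    and "density (measure_add \<mu> \<mu>') (RN_deriv (measure_add \<mu> \<mu>') \<mu>') = \<mu>'"
proof -
  let ?\<rho> = "measure_add \<mu> \<mu>'"
  have s: "sets \<mu> = sets \<mu>'" and f: "finite_measure \<mu>" "finite_measure \<mu>'"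
    using assms by (auto simp: finite_measures_def)
  have "finite_measure ?\<rho>"
    using f s sets_eq_imp_space_eq[OF s]
    by (intro finite_measureI)
       (auto simp: emeasure_measure_add finite_measure.emeasure_finite)
  then interpret \<rho>: finite_measure ?\<rho> .
  show "density ?\<rho> (RN_deriv ?\<rho> \<mu>) = \<mu>" "density ?\<rho> (RN_deriv ?\<rho> \<mu>') = \<mu>'"
    by (intro \<rho>.density_RN_deriv;
        auto simp: absolutely_continuous_def null_sets_def emeasure_measure_add s)+
qed

lemma hellinger_dominated:
  fixes f g :: "'a \<Rightarrow> real"
  assumes [measurable]: "f \<in> borel_measurable \<nu>" "g \<in> borel_measurable \<nu>"
    and nn: "\<And>x. 0 \<le> f x" "\<And>x. 0 \<le> g x"
    and fin: "finite_measure (density \<nu> f)" "finite_measure (density \<nu> g)"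
  shows "hellinger_sq (density \<nu> f) (density \<nu> g) = 1 / 2 * (\<integral>x. (sqrt (f x) - sqrt (g x))\<^sup>2 \<partial>\<nu>)"
proof -
  let ?\<mu> = "density \<nu> f" and ?\<mu>' = "density \<nu> g"
  define \<rho> where "\<rho> = measure_add ?\<mu> ?\<mu>'"
  define h where "h x = f x + g x" for x
  have [measurable]: "h \<in> borel_measurable \<nu>" by (simp add: h_def[abs_def])
  have \<rho>: "\<rho> = density \<nu> h"
    unfolding \<rho>_def
    by (rule measure_eqI)
       (auto simp: emeasure_measure_add emeasure_density h_def nn nn_integral_add[symmetric]
          distrib_right[symmetric] simp flip: ennreal_plus intro!: nn_integral_cong)
  have s: "sets \<rho> = sets \<nu>" by (simp add: \<rho>)
  define a where "a = RN_deriv \<rho> ?\<mu>"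
  define b where "b = RN_deriv \<rho> ?\<mu>'"
  have [measurable]: "a \<in> borel_measurable \<nu>" "b \<in> borel_measurable \<nu>"
    unfolding a_def b_def using borel_measurable_RN_deriv measurable_cong_sets[OF s refl] by blast+
  have mem: "?\<mu> \<in> finite_measures \<nu>" "?\<mu>' \<in> finite_measures \<nu>"
    using fin by (auto simp: finite_measures_def)
  have "density \<nu> (\<lambda>x. ennreal (h x) * a x) = density \<nu> f"
    using density_measure_add_RN_deriv(1)[OF mem]
    by (fold \<rho>_def, fold a_def) (simp add: \<rho> density_density_eq)
  moreover have "density \<nu> (\<lambda>x. ennreal (h x) * b x) = density \<nu> g"
    using density_measure_add_RN_deriv(2)[OF mem]
    by (fold \<rho>_def, fold b_def) (simp add: \<rho> density_density_eq)
  moreover have "integral\<^sup>N \<nu> f \<noteq> \<infinity>" "integral\<^sup>N \<nu> g \<noteq> \<infinity>"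
    using fin[THEN finite_measure.emeasure_finite, of "space \<nu>"]
    by (auto simp: emeasure_density cong: nn_integral_cong)
  ultimately have ae: "AE x in \<nu>. ennreal (f x) = ennreal (h x) * a x"
      "AE x in \<nu>. ennreal (g x) = ennreal (h x) * b x"
    by (subst finite_density_unique[symmetric]; simp)+
  have "(\<integral>x. (sqrt (enn2real (a x)) - sqrt (enn2real (b x)))\<^sup>2 \<partial>\<rho>)
      = (\<integral>x. h x * (sqrt (enn2real (a x)) - sqrt (enn2real (b x)))\<^sup>2 \<partial>\<nu>)"
    unfolding \<rho> by (subst integral_density) (auto simp: h_def nn)
  also have "\<dots> = (\<integral>x. (sqrt (f x) - sqrt (g x))\<^sup>2 \<partial>\<nu>)"
  proof (rule integral_cong_AE)
    show "AE x in \<nu>. h x * (sqrt (enn2real (a x)) - sqrt (enn2real (b x)))\<^sup>2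
        = (sqrt (f x) - sqrt (g x))\<^sup>2"
      using ae
    proof eventually_elim
      case (elim x)
      have h: "0 \<le> h x" by (simp add: h_def nn)
      have "f x = h x * enn2real (a x)" "g x = h x * enn2real (b x)"
        using elim[THEN arg_cong[of _ _ enn2real]] h nn by (auto simp: enn2real_mult)
      then show ?case
        using h by (simp add: real_sqrt_mult power_mult_distrib flip: right_diff_distrib)
    qed
  qed auto
  finally show ?thesis
    by (simp add: hellinger_sq_def Let_def flip: \<rho>_def a_def b_def)
qed

section \<open>Function spaces over the reference measure\<close>

text \<open>
  Elements of \<open>\<LL>\<^sub>1(\<lambda>)\<close> and \<open>\<LL>\<^sub>2(\<lambda>)\<close> are represented by real-valued functions, with equality
  understood almost everywhere.
\<close>

definition L1_nonneg :: "'a measure \<Rightarrow> ('a \<Rightarrow> real) set" where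
  "L1_nonneg lam = {t. integrable lam t \<and> (AE x in lam. 0 \<le> t x)}"

abbreviation weighted :: "('a \<Rightarrow> real) \<Rightarrow> 'a measure \<Rightarrow> 'a measure" where
  "weighted t lam \<equiv> density lam (\<lambda>x. ennreal (t x))"

definition Q_dom :: "'a measure \<Rightarrow> 'a measure set" where
  "Q_dom lam = {weighted t lam |t. t \<in> L1_nonneg lam}"

definition L2_space :: "'a measure \<Rightarrow> ('a \<Rightarrow> real) set" where
  "L2_space lam = {f \<in> borel_measurable lam. integrable lam (\<lambda>x. (f x)\<^sup>2)}"

definition L2_norm :: "'a measure \<Rightarrow> ('a \<Rightarrow> real) \<Rightarrow> real" where
  "L2_norm lam f = sqrt (\<integral>x. (f x)\<^sup>2 \<partial>lam)"

definition L2_subspace :: "'a measure \<Rightarrow> ('a \<Rightarrow> real) set \<Rightarrow> bool" where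
  "L2_subspace lam S \<longleftrightarrow>
     S \<subseteq> L2_space lam \<and> (\<lambda>_. 0) \<in> S \<and>
     (\<forall>f\<in>S. \<forall>g\<in>S. (\<lambda>x. f x + g x) \<in> S) \<and> (\<forall>c. \<forall>f\<in>S. (\<lambda>x. c * f x) \<in> S)"

text \<open>
  Linear independence and spanning are those of the quotient by almost-everywhere equality, so
  this is the dimension of the image of the subspace in \<open>\<LL>\<^sub>2(\<lambda>)\<close>.
\<close>

definition L2_dim :: "'a measure \<Rightarrow> ('a \<Rightarrow> real) set \<Rightarrow> nat \<Rightarrow> bool" where
  "L2_dim lam S D \<longleftrightarrow>
     (\<exists>\<phi>. (\<forall>i<D. \<phi> i \<in> S) \<and>
          (\<forall>c. (AE x in lam. (\<Sum>i<D. c i * \<phi> i x) = 0) \<longrightarrow> (\<forall>i<D. c i = 0)) \<and>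
          (\<forall>f\<in>S. \<exists>c. AE x in lam. f x = (\<Sum>i<D. c i * \<phi> i x)))"

text \<open>
  A null subspace (dimension \<open>0\<close>) has to carry a weight \<open>\<Delta> \<ge> 1\<close> in oracle inequalities whose risk term
  is \<open>D \<or> \<Delta>\<close> and which hold for one estimator and all powers \<open>q\<close>. For \<open>\<lambda> = \<delta>\<^sub>x\<close> and the models
  \<open>{0}\<close> and \<open>\<LL>\<^sub>2(\<lambda>)\<close>, both with \<open>\<Delta> = 0\<close>, letting \<open>\<mu> = R\<lambda>\<close> with \<open>R \<rightarrow> 0\<close> would force the
  estimator to vanish at every configuration, which fails as \<open>R \<rightarrow> \<infinity>\<close>.
\<close>

section \<open>Poisson processes\<close>

text \<open>
  The realisations of a finite point process are finite multisets of points, with the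
  \<open>\<sigma>\<close>-algebra generated by the counts \<open>N(A)\<close>.
\<close>

definition configurations :: "'a measure \<Rightarrow> 'a multiset measure" where
  "configurations M =
     sigma {X. set_mset X \<subseteq> space M}
       {{X. set_mset X \<subseteq> space M \<and> size (filter_mset (\<lambda>x. x \<in> A) X) = n} |A n. A \<in> sets M}"

text \<open>
  The law of a Poisson process with mean measure \<open>\<mu>\<close>. When \<open>\<mu>\<close> has mass zero there is no
  normalised measure, and \<^const>\<open>poisson_pmf\<close> is only specified for positive rates.
\<close>

definition poisson_process :: "'a measure \<Rightarrow> 'a multiset measure" where
  "poisson_process \<mu> =
     (if emeasure \<mu> (space \<mu>) = 0 then return (configurations \<mu>) {#}
      else measure_pmf (poisson_pmf (measure \<mu> (space \<mu>))) \<bind>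
        (\<lambda>n. distr (\<Pi>\<^sub>M i\<in>{..<n}. scale_measure (1 / emeasure \<mu> (space \<mu>)) \<mu>)
           (configurations \<mu>) (\<lambda>x. image_mset x (mset_set {..<n}))))"

lemma space_configurations [simp]: "space (configurations M) = {X. set_mset X \<subseteq> space M}"
  unfolding configurations_def by (rule space_measure_of) auto

lemma sets_configurations:
  "sets (configurations M) = sigma_sets {X. set_mset X \<subseteq> space M}
     {{X. set_mset X \<subseteq> space M \<and> size (filter_mset (\<lambda>x. x \<in> A) X) = n} |A n. A \<in> sets M}"
  unfolding configurations_def by (rule sets_measure_of) auto

lemma measurable_tuple_configurations:
  fixes n :: nat
  assumes "sets N = sets M"
  shows "(\<lambda>x. image_mset x (mset_set {..<n})) \<in> (\<Pi>\<^sub>M i\<in>{..<n}. N) \<rightarrow>\<^sub>M configurations M"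
  unfolding configurations_def
proof (rule measurable_measure_of)
  have sp: "space N = space M" using assms by (rule sets_eq_imp_space_eq)
  then show "(\<lambda>x. image_mset x (mset_set {..<n})) \<in> space (\<Pi>\<^sub>M i\<in>{..<n}. N) \<rightarrow> {X. set_mset X \<subseteq> space M}"
    by (auto simp: space_PiM elem_mset_set dest: PiE_mem)
  fix B assume "B \<in> {{X. set_mset X \<subseteq> space M \<and> size (filter_mset (\<lambda>x. x \<in> A) X) = k} |A k. A \<in> sets M}"
  then obtain A k where A: "A \<in> sets N" 
    and B: "B = {X. set_mset X \<subseteq> space M \<and> size (filter_mset (\<lambda>x. x \<in> A) X) = k}"
    using assms by auto
  have *: "size (filter_mset (\<lambda>y. y \<in> A) (image_mset x (mset_set {..<n}))) 
      = (\<Sum>i<n. (if x i \<in> A then 1 else 0))" for x :: "nat \<Rightarrow> 'a"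
    by (simp add: filter_mset_image_mset sum.If_cases Int_def)
  have "(\<lambda>x. image_mset x (mset_set {..<n})) -` B \<inter> space (\<Pi>\<^sub>M i\<in>{..<n}. N) 
     = {x \<in> space (\<Pi>\<^sub>M i\<in>{..<n}. N). (\<Sum>i<n. (if x i \<in> A then 1 else 0)) = k}"
    unfolding B using sp by (auto simp: * space_PiM elem_mset_set dest: PiE_mem)
  also have "\<dots> \<in> sets (\<Pi>\<^sub>M i\<in>{..<n}. N)"
    using A by measurable
  finally show "(\<lambda>x. image_mset x (mset_set {..<n})) -` B \<inter> space (\<Pi>\<^sub>M i\<in>{..<n}. N) \<in> sets (\<Pi>\<^sub>M i\<in>{..<n}. N)" .
qed auto

lemma prob_space_poisson_process:
  assumes "finite_measure \<mu>"
  shows "prob_space (poisson_process \<mu>)"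
    and "sets (poisson_process \<mu>) = sets (configurations \<mu>)"
proof -
  interpret finite_measure \<mu> by fact
  let ?N = "scale_measure (1 / emeasure \<mu> (space \<mu>)) \<mu>"
  have *: "(\<lambda>n. distr (\<Pi>\<^sub>M i\<in>{..<n}. ?N) (configurations \<mu>) (\<lambda>x. image_mset x (mset_set {..<n})))
      \<in> measure_pmf (poisson_pmf (measure \<mu> (space \<mu>))) \<rightarrow>\<^sub>M prob_algebra (configurations \<mu>)"
    if pos: "emeasure \<mu> (space \<mu>) \<noteq> 0"
  proof -
    have "emeasure \<mu> (space \<mu>) / emeasure \<mu> (space \<mu>) = 1"
      using pos emeasure_finite[of "space \<mu>"]
      by (intro ennreal_divide_self) (simp_all only: top.not_eq_extremum infinity_ennreal_def not_False_eq_True)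
    then have "prob_space ?N"
      by (intro prob_spaceI) (simp add: space_scale_measure ennreal_divide_times)
    then show ?thesis
      by (auto simp: space_prob_algebra intro!: prob_space.prob_space_distr prob_space_PiM
            measurable_tuple_configurations)
  qed
  have pmf: "measure_pmf p \<in> space (prob_algebra (count_space UNIV))" for p :: "nat pmf"
    by (simp add: space_prob_algebra measure_pmf.prob_space_axioms)
  show "prob_space (poisson_process \<mu>)"
    unfolding poisson_process_def using * prob_space_bind'[OF pmf]
    by (auto intro!: prob_space_return)
  show "sets (poisson_process \<mu>) = sets (configurations \<mu>)"
    unfolding poisson_process_def using * sets_bind'[OF pmf] by auto
qed

section \<open>Estimators\<close>

text \<open>
  The Borel \<open>\<sigma>\<close>-algebra of \<^term>\<open>Q_dom lam\<close> for the Hellinger metric, generated by all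
  metrically open sets; it makes \<open>H(\<mu>, \<cdot>)\<close> measurable for every finite \<open>\<mu>\<close>.
\<close>

definition Q_dom_open :: "'a measure \<Rightarrow> 'a measure set \<Rightarrow> bool" where
  "Q_dom_open lam U \<longleftrightarrow> U \<subseteq> Q_dom lam \<and>
     (\<forall>\<nu>\<in>U. \<exists>r>0. \<forall>\<nu>'\<in>Q_dom lam. hellinger \<nu> \<nu>' < r \<longrightarrow> \<nu>' \<in> U)"

definition Q_dom_borel :: "'a measure \<Rightarrow> 'a measure measure" where
  "Q_dom_borel lam = sigma (Q_dom lam) {U. Q_dom_open lam U}"

definition density_estimator :: "'a measure \<Rightarrow> ('a multiset \<Rightarrow> 'a \<Rightarrow> real) \<Rightarrow> bool" where
  "density_estimator lam s_hat \<longleftrightarrow>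
     (\<forall>X\<in>space (configurations lam). s_hat X \<in> L1_nonneg lam) \<and>
     (\<lambda>X. weighted (s_hat X) lam) \<in> configurations lam \<rightarrow>\<^sub>M Q_dom_borel lam"

end

theory Submission
  imports Defs
begin

text \<open>
  For mean measures with densities the Hellinger distance is Hilbertian:
  \<open>H\<^sup>2(\<mu>, t\<^sup>2 \<cdot> \<lambda>)\<close> is half of \<open>\<parallel>\<surd>s - t\<parallel>\<^sup>2 + \<mu>\<^sup>\<bottom>(\<X>)\<close> for \<open>t \<ge> 0\<close>. So the problem is to
  estimate \<open>\<surd>s\<close> in \<open>\<LL>\<^sub>2(\<lambda>)\<close>, and the estimator is \<open>t\<^sup>2 \<cdot> \<lambda>\<close> for a \<open>t\<close> selected from a countable set of
  nonnegative candidates.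

  \<^emph>\<open>Comparing two candidates.\<close> For \<open>f, g \<ge> 0\<close> let \<open>a = (3f + g)/4\<close> and \<open>b = (f + 3g)/4\<close> be two points
  of the segment from \<open>f\<close> to \<open>g\<close>. The score of \<open>g\<close> against \<open>f\<close> is
  \<open>\<Sum> ln (b/a)(X\<^sub>i) - (\<parallel>b\<parallel>\<^sup>2 - \<parallel>a\<parallel>\<^sup>2)/2\<close>. Since \<open>b/a \<le> 3\<close>, the score is robust against an arbitrary
  \<open>\<mu>\<close>; the formula for the Laplace functional of a Poisson process and an elementary pointwise
  inequality (\<open>log_ratio_inequality\<close>) give
  \<open>E exp(score) \<le> exp(2 (\<parallel>\<surd>s - f\<parallel>\<^sup>2 + \<mu>\<^sup>\<bottom>(\<X>)) - \<parallel>f - g\<parallel>\<^sup>2/4)\<close> (\<open>exp_score_moment\<close>). So a candidate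
  far from \<open>f\<close> is unlikely to beat \<open>f\<close> when \<open>f\<close> is close to the truth.

  \<^emph>\<open>Selecting one.\<close> Give candidate \<open>j\<close> a penalty \<open>w\<^sub>j\<close> and select a near-minimiser of
  \<open>sup\<^sub>i (score of i against j - w\<^sub>i) + w\<^sub>j\<close>. The scores are antisymmetric, so the score of the selected
  candidate against a fixed reference \<open>i\<close> controls their distance. One random variable does
  this for all candidates at once, namely \<open>Z = \<Sum>\<^sub>j exp(score - 2 err\<^sub>i + \<parallel>t\<^sub>i - t\<^sub>j\<parallel>\<^sup>2/8 - w\<^sub>j)\<close>:
  the squared loss is at most of the order of \<open>(err\<^sub>i + w\<^sub>i + 1) (1 + ln(1 + Z))\<close>, and
  \<open>E Z \<le> \<Sum>\<^sub>j exp(- \<parallel>t\<^sub>i - t\<^sub>j\<parallel>\<^sup>2/8 - w\<^sub>j)\<close>. As powers of \<open>1 + ln(1 + Z)\<close> are dominated by \<open>1 + Z\<close>, the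
  risk is bounded for every \<open>q\<close> simultaneously (\<open>selected_risk\<close>).

  \<^emph>\<open>The candidates.\<close> In each model take the points \<open>u\<close> with integer coordinates in an orthonormal basis;
  they approximate the model up to the square root of its dimension. The candidate is the positive part
  of \<open>u\<close>. Distinct lattice points may have close positive parts, so the penalty contains the squared norm of
  the negative part besides a multiple of \<open>D \<or> \<Delta>\<close>: the distance from a nonnegative function to the positive
  part and the penalty together dominate its distance to \<open>u\<close>, and by Bessel's inequality the sum is at most a
  product of one-dimensional Gaussian sums, of order \<open>K\<^sup>D\<close>. The extra term costs nothing, because the negative part of \<open>u\<close> is
  never longer than \<open>\<surd>s - u\<close>. The multiple of \<open>D \<or> \<Delta>\<close> absorbs \<open>K\<^sup>D\<close> and leaves \<open>exp(- \<Delta>)\<close>, whose sum is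
  at most \<open>\<Sigma>\<close>.
\<close>

section \<open>Exponential moments of Poisson processes\<close>

lemma nn_integral_measure_add:
  assumes s: "sets \<mu> = sets \<nu>" and f: "f \<in> borel_measurable \<mu>"
  shows "(\<integral>\<^sup>+x. f x \<partial>measure_add \<mu> \<nu>) = (\<integral>\<^sup>+x. f x \<partial>\<mu>) + (\<integral>\<^sup>+x. f x \<partial>\<nu>)"
proof -
  have ms: "measurable \<nu> borel = measurable \<mu> (borel :: ennreal measure)"
    "measurable (measure_add \<mu> \<nu>) borel = measurable \<mu> (borel :: ennreal measure)"
    by (rule measurable_cong_sets; simp add: s)+
  show ?thesis
    using f
  proof induction
    case (cong f g)
    note cong(3)
    moreover have "space \<mu> = space \<nu>" using s by (rule sets_eq_imp_space_eq)
    ultimately have "integral\<^sup>N \<mu> f = integral\<^sup>N \<mu> g" "integral\<^sup>N \<nu> f = integral\<^sup>N \<nu> g"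
      "integral\<^sup>N (measure_add \<mu> \<nu>) f = integral\<^sup>N (measure_add \<mu> \<nu>) g"
      by (auto intro!: nn_integral_cong)
    then show ?case using cong(4) by metis
  next
    case (set A)
    then show ?case using s by (simp add: emeasure_measure_add)
  next
    case (mult u c)
    then have [measurable]: "u \<in> borel_measurable \<mu>" "u \<in> borel_measurable \<nu>"
      "u \<in> borel_measurable (measure_add \<mu> \<nu>)"
      unfolding ms by simp_all
    show ?case using mult by (simp add: nn_integral_cmult distrib_left)
  next
    case (add u v)
    then have [measurable]: "u \<in> borel_measurable \<mu>" "u \<in> borel_measurable \<nu>"
      "u \<in> borel_measurable (measure_add \<mu> \<nu>)" "v \<in> borel_measurable \<mu>" "v \<in> borel_measurable \<nu>"
      "v \<in> borel_measurable (measure_add \<mu> \<nu>)"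
      unfolding ms by simp_all
    show ?case using add by (simp add: nn_integral_add ac_simps)
  next
    case (seq U)
    have m: "U i \<in> borel_measurable \<mu>" "U i \<in> borel_measurable \<nu>"
      "U i \<in> borel_measurable (measure_add \<mu> \<nu>)" for i
      using seq(1) unfolding ms by simp_all
    have i: "incseq (\<lambda>i. integral\<^sup>N \<mu> (U i))" "incseq (\<lambda>i. integral\<^sup>N \<nu> (U i))"
      using \<open>incseq U\<close> by (auto simp: incseq_def le_fun_def intro!: nn_integral_mono)
    have SUP: "integral\<^sup>N N' (SUP i. U i) = (SUP i. integral\<^sup>N N' (U i))"
      if "\<And>i. U i \<in> borel_measurable N'" for N'
      unfolding SUP_apply by (rule nn_integral_monotone_convergence_SUP[OF \<open>incseq U\<close> that])
    show ?case
      unfolding SUP[OF m(1)] SUP[OF m(2)] SUP[OF m(3)] seq.IH by (rule ennreal_SUP_add[OF i])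
  qed
qed

text \<open>
  The counts generate the \<open>\<sigma>\<close>-algebra of configurations, which is the case of an indicator; the rest follows
  by monotone approximation, separately for the positive and the negative part.
\<close>

lemma borel_measurable_sum_mset_configurations [measurable]:
  fixes f :: "'a \<Rightarrow> real"
  assumes "f \<in> borel_measurable M"
  shows "(\<lambda>X. \<Sum>x\<in>#X. f x) \<in> borel_measurable (configurations M)"
proof -
  have nonneg: "(\<lambda>X. \<Sum>x\<in>#X. u x) \<in> borel_measurable (configurations M)"
    if "u \<in> borel_measurable M" "\<And>x. 0 \<le> u x" for u :: "'a \<Rightarrow> real"
    using that
  proof (induction rule: borel_measurable_induct_real)
    case (set A)
    have "(\<lambda>X. size (filter_mset (\<lambda>x. x \<in> A) X)) \<in> configurations M \<rightarrow>\<^sub>M count_space UNIV"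
    proof (subst measurable_count_space_eq_countable, simp, intro conjI ballI)
      fix k :: nat
      have "(\<lambda>X. size (filter_mset (\<lambda>x. x \<in> A) X)) -` {k} \<inter> space (configurations M)
         = {X. set_mset X \<subseteq> space M \<and> size (filter_mset (\<lambda>x. x \<in> A) X) = k}"
        by auto
      then show "(\<lambda>X. size (filter_mset (\<lambda>x. x \<in> A) X)) -` {k} \<inter> space (configurations M)
          \<in> sets (configurations M)" unfolding sets_configurations using set by (auto intro!: sigma_sets.Basic)
    qed simp
    moreover have "(\<Sum>x\<in>#X. indicator A x) = real (size (filter_mset (\<lambda>x. x \<in> A) X))" for X
      by (induction X) auto
    ultimately show ?case by simp
  next
    case (mult u c)
    then show ?case by (simp flip: sum_mset_distrib_left)
  next
    case (add u v)
    then show ?case by (simp add: sum_mset.distrib)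
  next
    case (seq U)
    show ?case
    proof (rule borel_measurable_LIMSEQ_real)
      fix X assume "X \<in> space (configurations M)"
      then have "set_mset X \<subseteq> space M" by simp
      then show "(\<lambda>i. \<Sum>x\<in>#X. U i x) \<longlonglongrightarrow> (\<Sum>x\<in>#X. u x)"
        by (induction X) (auto intro!: tendsto_intros seq)
    qed (use seq in auto)
  qed
  have "(\<lambda>X. (\<Sum>x\<in>#X. max 0 (f x)) - (\<Sum>x\<in>#X. max 0 (- f x))) \<in> borel_measurable (configurations M)"
    using assms by (intro borel_measurable_diff nonneg) auto
  also have "(\<lambda>X. (\<Sum>x\<in>#X. max 0 (f x)) - (\<Sum>x\<in>#X. max 0 (- f x))) = (\<lambda>X. \<Sum>x\<in>#X. f x)"
  proof
    fix X show "(\<Sum>x\<in>#X. max 0 (f x)) - (\<Sum>x\<in>#X. max 0 (- f x)) = (\<Sum>x\<in>#X. f x)"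
      by (induction X) auto
  qed
  finally show ?thesis .
qed

text \<open>
  The Laplace functional: given \<open>N = n\<close> the points are independent, so the conditional expectation is
  \<open>(I/r)\<^sup>n\<close> with \<open>r\<close> the total mass and \<open>I\<close> the integral of \<open>exp f\<close>, and averaging over the Poisson law
  of \<open>N\<close> gives an exponential series.
\<close>

lemma nn_integral_exp_sum_poisson_process:
  fixes f :: "'a \<Rightarrow> real"
  assumes \<mu>: "finite_measure \<mu>" and f [measurable]: "f \<in> borel_measurable \<mu>"
    and int: "integrable \<mu> (\<lambda>x. exp (f x))"
  shows "(\<integral>\<^sup>+X. ennreal (exp (\<Sum>x\<in>#X. f x)) \<partial>poisson_process \<mu>)
     = ennreal (exp ((\<integral>x. exp (f x) \<partial>\<mu>) - measure \<mu> (space \<mu>)))"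
proof (cases "emeasure \<mu> (space \<mu>) = 0")
  case True
  interpret finite_measure \<mu> by fact
  have "(\<integral>x. exp (f x) \<partial>\<mu>) = (\<integral>x. 0 \<partial>\<mu>)"
    using True by (intro integral_cong_AE) (auto intro!: AE_I[of _ _ "space \<mu>"])
  moreover have "(\<integral>\<^sup>+X. ennreal (exp (\<Sum>x\<in>#X. f x)) \<partial>return (configurations \<mu>) {#}) = 1"
    by (subst nn_integral_return) auto
  ultimately show ?thesis
    using True by (simp add: poisson_process_def measure_def)
next
  case False
  interpret finite_measure \<mu> by fact
  define r where "r = measure \<mu> (space \<mu>)"
  have r: "emeasure \<mu> (space \<mu>) = ennreal r" "r > 0"
    using False by (auto simp: r_def emeasure_eq_measure zero_less_measure_iff)
  define N where "N = scale_measure (1 / emeasure \<mu> (space \<mu>)) \<mu>"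
  define I where "I = (\<integral>x. exp (f x) \<partial>\<mu>)"
  have I: "(\<integral>\<^sup>+x. ennreal (exp (f x)) \<partial>\<mu>) = ennreal I" "I \<ge> 0"
    unfolding I_def using int by (auto simp: nn_integral_eq_integral)
  have "prob_space N"
    using r by (intro prob_spaceI) (simp add: N_def space_scale_measure ennreal_divide_times)
  then interpret N: prob_space N .
  interpret P: product_sigma_finite "\<lambda>_::nat. N" ..
  have sN: "sets N = sets \<mu>" by (simp add: N_def)
  have fN [measurable]: "f \<in> borel_measurable N"
    using f unfolding measurable_cong_sets[OF sN refl] .
  have tuple [measurable]:
    "(\<lambda>x. image_mset x (mset_set {..<n})) \<in> (\<Pi>\<^sub>M i\<in>{..<n}. N) \<rightarrow>\<^sub>M configurations \<mu>" for n :: nat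
    using sN by (rule measurable_tuple_configurations)
  let ?D = "\<lambda>n. distr (\<Pi>\<^sub>M i\<in>{..<n}. N) (configurations \<mu>) (\<lambda>x. image_mset x (mset_set {..<n}))"
  have D: "?D \<in> measure_pmf (poisson_pmf r) \<rightarrow>\<^sub>M subprob_algebra (configurations \<mu>)"
    by (auto simp: space_subprob_algebra intro!: prob_space_imp_subprob_space
        prob_space.prob_space_distr prob_space_PiM N.prob_space_axioms)
  have "(\<integral>\<^sup>+x. ennreal (exp (f x)) \<partial>N) = ennreal (1 / r) * ennreal I"
    unfolding N_def using r by (simp add: nn_integral_scale_measure I divide_ennreal flip: ennreal_1)
  also have "\<dots> = ennreal (I / r)"
    using r I by (simp flip: ennreal_mult)
  finally have one: "(\<integral>\<^sup>+x. ennreal (exp (f x)) \<partial>N) = ennreal (I / r)" .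
  have n: "(\<integral>\<^sup>+X. ennreal (exp (\<Sum>x\<in>#X. f x)) \<partial>?D n) = ennreal ((I / r) ^ n)" for n
  proof -
    have "(\<integral>\<^sup>+X. ennreal (exp (\<Sum>x\<in>#X. f x)) \<partial>?D n)
      = (\<integral>\<^sup>+x. (\<Prod>i<n. ennreal (exp (f (x i)))) \<partial>(\<Pi>\<^sub>M i\<in>{..<n}. N))"
      by (subst nn_integral_distr)
        (simp_all add: sum_unfold_sum_mset[symmetric] image_mset.compositionality comp_def exp_sum prod_ennreal)
    also have "\<dots> = (\<Prod>i<n. \<integral>\<^sup>+x. ennreal (exp (f x)) \<partial>N)"
      by (rule P.product_nn_integral_prod) auto
    finally show ?thesis using I r by (simp add: one ennreal_power)
  qed
  have "(\<integral>\<^sup>+X. ennreal (exp (\<Sum>x\<in>#X. f x)) \<partial>poisson_process \<mu>)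
      = (\<integral>\<^sup>+X. ennreal (exp (\<Sum>x\<in>#X. f x)) \<partial>(measure_pmf (poisson_pmf r) \<bind> ?D))"
    using False by (simp add: poisson_process_def N_def r_def)
  also have "\<dots> = (\<integral>\<^sup>+n. ennreal ((I / r) ^ n) \<partial>measure_pmf (poisson_pmf r))"
    by (subst nn_integral_bind[OF _ D]) (auto simp: n)
  also have "\<dots> = (\<Sum>n. ennreal (exp (- r) * (I ^ n /\<^sub>R fact n)))"
    using r I by (simp add: nn_integral_measure_pmf nn_integral_count_space_nat power_divide
        field_simps flip: ennreal_mult)
  also have "\<dots> = ennreal (exp (- r) * exp I)"
    using I by (intro suminf_ennreal_eq sums_mult exp_converges) auto
  finally show ?thesis
    by (simp add: I_def r_def exp_diff exp_minus field_simps)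
qed

lemma configurations_cong: "sets M = sets N \<Longrightarrow> configurations M = configurations N"
  by (simp add: configurations_def sets_eq_imp_space_eq[of M N])

section \<open>Square-integrable functions\<close>

lemma L2_spaceD:
  assumes "f \<in> L2_space M"
  shows "f \<in> borel_measurable M" "integrable M (\<lambda>x. (f x)\<^sup>2)"
  using assms by (auto simp: L2_space_def)

lemma L2_space_integrable_mult:
  assumes "f \<in> L2_space M" "g \<in> L2_space M"
  shows "integrable M (\<lambda>x. f x * g x)"
proof (rule Bochner_Integration.integrable_bound)
  show "integrable M (\<lambda>x. (f x)\<^sup>2 + (g x)\<^sup>2)"
    using assms by (intro Bochner_Integration.integrable_add L2_spaceD)
  have "\<bar>a * b\<bar> \<le> a\<^sup>2 + b\<^sup>2" for a b :: real
    using sum_squares_bound[of "\<bar>a\<bar>" "\<bar>b\<bar>"] mult_nonneg_nonneg[of "\<bar>a\<bar>" "\<bar>b\<bar>"]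
    unfolding abs_mult power2_abs by linarith
  then show "AE x in M. norm (f x * g x) \<le> norm ((f x)\<^sup>2 + (g x)\<^sup>2)"
    by simp
qed (use assms[THEN L2_spaceD(1)] in auto)

lemma L2_space_zero [simp]: "(\<lambda>_. 0) \<in> L2_space M"
  by (simp add: L2_space_def)

lemma L2_space_add:
  assumes "f \<in> L2_space M" "g \<in> L2_space M"
  shows "(\<lambda>x. f x + g x) \<in> L2_space M"
  using assms L2_space_integrable_mult[OF assms]
  by (auto simp: L2_space_def power2_sum mult.assoc)

lemma L2_space_cmult: "f \<in> L2_space M \<Longrightarrow> (\<lambda>x. c * f x) \<in> L2_space M"
  by (auto simp: L2_space_def power_mult_distrib)

lemma L2_space_diff:
  assumes "f \<in> L2_space M" "g \<in> L2_space M"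
  shows "(\<lambda>x. f x - g x) \<in> L2_space M"
  using L2_space_add[OF assms(1) L2_space_cmult[OF assms(2), of "-1"]] by simp

lemma L2_space_sum:
  assumes "\<And>i. i \<in> A \<Longrightarrow> f i \<in> L2_space M"
  shows "(\<lambda>x. \<Sum>i\<in>A. f i x) \<in> L2_space M"
  using assms by (induction A rule: infinite_finite_induct) (auto intro: L2_space_add)

lemma L2_space_bound:
  assumes "f \<in> L2_space M" "g \<in> borel_measurable M" "\<And>x. \<bar>g x\<bar> \<le> \<bar>f x\<bar>"
  shows "g \<in> L2_space M"
proof -
  have "integrable M (\<lambda>x. (g x)\<^sup>2)"
    using assms by (intro Bochner_Integration.integrable_bound[OF L2_spaceD(2)[OF assms(1)]])
      (auto simp: abs_le_square_iff)
  then show ?thesis using assms by (simp add: L2_space_def)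
qed

lemma sqrt_L1_nonneg:
  assumes "s \<in> L1_nonneg M"
  shows "(\<lambda>x. sqrt (s x)) \<in> L2_space M"
proof -
  have "integrable M (\<lambda>x. (sqrt (s x))\<^sup>2) \<longleftrightarrow> integrable M s"
    using assms by (intro integrable_cong_AE) (auto simp: L1_nonneg_def)
  then show ?thesis using assms by (auto simp: L1_nonneg_def L2_space_def)
qed

lemma integral_square_triangle:
  assumes "(\<lambda>x. f x - g x) \<in> L2_space M" "(\<lambda>x. g x - h x) \<in> L2_space M"
  shows "(\<integral>x. (f x - h x)\<^sup>2 \<partial>M) \<le> 2 * (\<integral>x. (f x - g x)\<^sup>2 \<partial>M) + 2 * (\<integral>x. (g x - h x)\<^sup>2 \<partial>M)"
proof -
  have int: "integrable M (\<lambda>x. 2 * (f x - g x)\<^sup>2 + 2 * (g x - h x)\<^sup>2)"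
    using assms[THEN L2_spaceD(2)] by simp
  have "(f x - h x)\<^sup>2 \<le> 2 * (f x - g x)\<^sup>2 + 2 * (g x - h x)\<^sup>2" for x
    using sum_squares_bound[of "f x - g x" "g x - h x"] by (simp add: power2_eq_square algebra_simps)
  then have "(\<integral>x. (f x - h x)\<^sup>2 \<partial>M) \<le> (\<integral>x. 2 * (f x - g x)\<^sup>2 + 2 * (g x - h x)\<^sup>2 \<partial>M)"
    using L2_spaceD[OF L2_space_add[OF assms]] by (intro integral_mono int) auto
  also have "\<dots> = 2 * (\<integral>x. (f x - g x)\<^sup>2 \<partial>M) + 2 * (\<integral>x. (g x - h x)\<^sup>2 \<partial>M)"
    using assms[THEN L2_spaceD(2)] by simp
  finally show ?thesis .
qed

section \<open>Robust comparison of two square roots of densities\<close>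

text \<open>
  The logarithm of \<open>b/a\<close> with \<open>a = (3x + y)/4\<close> and \<open>b = (x + 3y)/4\<close>. A difference of logarithms is
  antisymmetric and vanishes at \<open>x = y = 0\<close> whatever the value of \<open>ln 0\<close>.
\<close>

definition log_ratio :: "real \<Rightarrow> real \<Rightarrow> real" where
  "log_ratio x y = ln (x + 3 * y) - ln (3 * x + y)"

lemma measurable_log_ratio [measurable]:
  assumes [measurable]: "f \<in> borel_measurable M" "g \<in> borel_measurable M"
  shows "(\<lambda>x. log_ratio (f x) (g x)) \<in> borel_measurable M"
  unfolding log_ratio_def by measurable

lemma exp_log_ratio:
  assumes "0 \<le> x" "0 \<le> y" "x \<noteq> 0 \<or> y \<noteq> 0"
  shows "exp (log_ratio x y) = (x + 3 * y) / (3 * x + y)"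
proof -
  have "x + 3 * y > 0" "3 * x + y > 0" using assms by (auto simp: add_pos_nonneg add_nonneg_pos less_le)
  then show ?thesis by (simp add: log_ratio_def exp_diff)
qed

lemma exp_log_ratio_le:
  assumes "0 \<le> x" "0 \<le> y"
  shows "exp (log_ratio x y) \<le> 3"
proof (cases "x = 0 \<and> y = 0")
  case True then show ?thesis by (simp add: log_ratio_def)
next
  case False
  then have "3 * x + y > 0" using assms by (auto simp: add_pos_nonneg add_nonneg_pos less_le)
  with False assms show ?thesis by (auto simp: exp_log_ratio divide_le_eq)
qed

text \<open>
  The core of the robust test. Writing \<open>z\<^sup>2 = a\<^sup>2 + 2a(z - a) + (z - a)\<^sup>2\<close>, only the last term is not linear in
  \<open>z - a\<close> after multiplication by \<open>b/a - 1\<close>, and there \<open>b/a - 1 \<le> 2\<close>. Replacing \<open>b/a - 1\<close> by \<open>2\<close> in that term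
  gives precisely the right-hand side; the defect is \<open>8x/p (z - a)\<^sup>2\<close> with \<open>p = 3x + y\<close>.
\<close>

lemma log_ratio_inequality:
  assumes "0 \<le> x" "0 \<le> y"
  shows "(exp (log_ratio x y) - 1) * z\<^sup>2 \<le> (y\<^sup>2 - x\<^sup>2) / 4 + 2 * (z - x)\<^sup>2 - (x - y)\<^sup>2 / 4"
proof (cases "x = 0 \<and> y = 0")
  case True then show ?thesis by (simp add: log_ratio_def)
next
  case False
  define p where "p = 3 * x + y"
  have p: "p > 0" and y: "y = p - 3 * x"
    using False assms by (auto simp: p_def add_pos_nonneg add_nonneg_pos less_le)
  have e: "exp (log_ratio x y) = (x + 3 * y) / p"
    using exp_log_ratio[of x y] assms False by (auto simp: p_def)
  have "(y\<^sup>2 - x\<^sup>2) / 4 + 2 * (z - x)\<^sup>2 - (x - y)\<^sup>2 / 4 - (exp (log_ratio x y) - 1) * z\<^sup>2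
     = 8 * x / p * (z - p / 4)\<^sup>2"
    using p unfolding e unfolding y by (simp add: field_simps power2_eq_square)
  also have "\<dots> \<ge> 0" using p assms by simp
  finally show ?thesis by simp
qed

text \<open>
  The compensator is \<open>(\<parallel>b\<parallel>\<^sup>2 - \<parallel>a\<parallel>\<^sup>2)/2\<close> for the interpolated functions \<open>a = (3f + g)/4\<close> and
  \<open>b = (f + 3g)/4\<close>, which equals a quarter of \<open>\<parallel>g\<parallel>\<^sup>2 - \<parallel>f\<parallel>\<^sup>2\<close>. Positive scores speak for \<open>g\<close>.
\<close>

definition score :: "'a measure \<Rightarrow> ('a \<Rightarrow> real) \<Rightarrow> ('a \<Rightarrow> real) \<Rightarrow> 'a multiset \<Rightarrow> real" where
  "score M f g X = (\<Sum>x\<in>#X. log_ratio (f x) (g x)) - ((\<integral>x. (g x)\<^sup>2 \<partial>M) - (\<integral>x. (f x)\<^sup>2 \<partial>M)) / 4"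

lemma score_self [simp]: "score M f f X = 0"
  by (simp add: score_def log_ratio_def add.commute)

lemma score_swap: "score M g f X = - score M f g X"
proof -
  have "(\<Sum>x\<in>#X. log_ratio (g x) (f x)) = - (\<Sum>x\<in>#X. log_ratio (f x) (g x))"
    by (induction X) (auto simp: log_ratio_def add.commute)
  then show ?thesis by (simp add: score_def algebra_simps diff_divide_distrib)
qed

lemma measurable_score:
  assumes [measurable]: "f \<in> borel_measurable M" "g \<in> borel_measurable M"
  shows "score M f g \<in> borel_measurable (configurations M)"
  unfolding score_def[abs_def] by measurable

text \<open>
  A mean measure split into a part with density \<open>s\<close> and a contamination \<open>N\<close>.
\<close>

locale mean_measure =
  fixes M :: "'a measure" and s :: "'a \<Rightarrow> real" and N :: "'a measure"
  assumes s: "s \<in> L1_nonneg M" and N: "N \<in> finite_measures M"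
begin

abbreviation mean :: "'a measure" where
  "mean \<equiv> measure_add (weighted s M) N"

lemma s_integrable [simp]: "integrable M s" and s_nonneg: "AE x in M. 0 \<le> s x"
  and s_measurable [measurable]: "s \<in> borel_measurable M"
  using s by (auto simp: L1_nonneg_def)

lemma sets_N [measurable_cong]: "sets N = sets M" and finite_N: "finite_measure N"
  using N by (auto simp: finite_measures_def)

lemma nn_integral_mean:
  fixes h :: "'a \<Rightarrow> ennreal"
  assumes [measurable]: "h \<in> borel_measurable M"
  shows "(\<integral>\<^sup>+x. h x \<partial>mean) = (\<integral>\<^sup>+x. ennreal (s x) * h x \<partial>M) + (\<integral>\<^sup>+x. h x \<partial>N)"
  by (subst nn_integral_measure_add) (auto simp: sets_N nn_integral_density)

lemma integral_mean:
  assumes [measurable]: "h \<in> borel_measurable M" and h: "\<And>x. 0 \<le> h x" "\<And>x. h x \<le> B"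
  shows "integrable mean h" "integrable M (\<lambda>x. h x * s x)" "integrable N h"
    "(\<integral>x. h x \<partial>mean) = (\<integral>x. h x * s x \<partial>M) + (\<integral>x. h x \<partial>N)"
proof -
  interpret N: finite_measure N by (rule finite_N)
  show iN: "integrable N h"
    using h by (intro N.integrable_const_bound[of _ B]) auto
  show iM: "integrable M (\<lambda>x. h x * s x)"
  proof (rule Bochner_Integration.integrable_bound)
    show "integrable M (\<lambda>x. B * s x)" by simp
    have "0 \<le> B" using h order_trans by blast
    then show "AE x in M. norm (h x * s x) \<le> norm (B * s x)"
      using h by (auto simp: abs_mult intro!: mult_right_mono)
  qed auto
  have "(\<integral>\<^sup>+x. ennreal (s x) * ennreal (h x) \<partial>M) = (\<integral>\<^sup>+x. ennreal (h x * s x) \<partial>M)"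
    using h s_nonneg by (intro nn_integral_cong_AE) (auto simp: ennreal_mult mult.commute)
  also have "\<dots> = ennreal (\<integral>x. h x * s x \<partial>M)"
    using h s_nonneg iM by (intro nn_integral_eq_integral) auto
  finally have M: "(\<integral>\<^sup>+x. ennreal (s x) * ennreal (h x) \<partial>M) = ennreal (\<integral>x. h x * s x \<partial>M)" .
  have nn: "0 \<le> (\<integral>x. h x * s x \<partial>M)" "0 \<le> (\<integral>x. h x \<partial>N)"
    using h s_nonneg by (auto intro!: integral_nonneg_AE)
  have *: "(\<integral>\<^sup>+x. ennreal (h x) \<partial>mean) = ennreal ((\<integral>x. h x * s x \<partial>M) + (\<integral>x. h x \<partial>N))"
    using iN h nn
    by (simp add: M nn_integral_mean nn_integral_eq_integral)
  have "AE x in mean. 0 \<le> h x" and hm: "h \<in> borel_measurable mean"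
    using h by (auto cong: measurable_cong_sets)
  then show "integrable mean h"
    using * by (auto intro!: integrableI_nonneg)
  have "(\<integral>x. h x \<partial>mean) = enn2real (\<integral>\<^sup>+x. ennreal (h x) \<partial>mean)"
    using h hm by (intro integral_eq_nn_integral) auto
  also have "\<dots> = (\<integral>x. h x * s x \<partial>M) + (\<integral>x. h x \<partial>N)"
    unfolding * using nn by (intro enn2real_ennreal) simp
  finally show "(\<integral>x. h x \<partial>mean) = (\<integral>x. h x * s x \<partial>M) + (\<integral>x. h x \<partial>N)" .
qed

lemma measure_mean: "measure mean (space mean) = (\<integral>x. s x \<partial>M) + measure N (space N)"
  using integral_mean(4)[of "\<lambda>_. 1" 1] by simp

lemma finite_measure_mean: "finite_measure mean"
  using integral_mean(1)[of "\<lambda>_. 1" 1]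
  by (auto intro!: finite_measureI simp: integrable_iff_bounded less_top)

text \<open>
  Twice the squared Hellinger distance from the mean measure to the measure with density \<open>f\<^sup>2\<close> when \<open>f \<ge> 0\<close>
  and \<open>N\<close> is orthogonal to \<open>M\<close>.
\<close>

definition err :: "('a \<Rightarrow> real) \<Rightarrow> real" where
  "err f = (\<integral>x. (sqrt (s x) - f x)\<^sup>2 \<partial>M) + measure N (space N)"

lemma err_nonneg: "0 \<le> err f"
  by (simp add: err_def)

text \<open>
  On the absolutely continuous part the exponent of the Laplace functional is bounded by integrating the
  pointwise inequality at \<open>z = \<surd>s\<close>; on \<open>N\<close> all that is known of the ratio is that it is at most \<open>3\<close>, which
  costs \<open>2 N(\<X>)\<close> and explains why \<open>N\<close> enters \<open>err\<close> with the same weight as the squared distance.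
\<close>

lemma exp_score_moment:
  assumes f: "f \<in> L2_space M" "\<And>x. 0 \<le> f x" and g: "g \<in> L2_space M" "\<And>x. 0 \<le> g x"
  shows "(\<integral>\<^sup>+X. ennreal (exp (score M f g X)) \<partial>poisson_process mean)
     \<le> ennreal (exp (2 * err f - (\<integral>x. (f x - g x)\<^sup>2 \<partial>M) / 4))"
proof -
  have [measurable]: "f \<in> borel_measurable M" "g \<in> borel_measurable M"
    using f g by (auto dest: L2_spaceD)
  define h where "h x = exp (log_ratio (f x) (g x))" for x
  have h: "h \<in> borel_measurable M" "\<And>x. 0 \<le> h x" "\<And>x. h x \<le> 3"
    unfolding h_def using exp_log_ratio_le f g by auto
  note ih = integral_mean[OF h]
  have i: "integrable M (\<lambda>x. (f x)\<^sup>2)" "integrable M (\<lambda>x. (g x)\<^sup>2)"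
    "integrable M (\<lambda>x. (sqrt (s x) - f x)\<^sup>2)" "integrable M (\<lambda>x. (f x - g x)\<^sup>2)"
    using f g sqrt_L1_nonneg[OF s] by (auto intro!: L2_spaceD L2_space_diff)
  define c where "c = ((\<integral>x. (g x)\<^sup>2 \<partial>M) - (\<integral>x. (f x)\<^sup>2 \<partial>M)) / 4"
  interpret N: finite_measure N by (rule finite_N)
  have "(\<integral>x. h x \<partial>N) \<le> (\<integral>x. 3 \<partial>N)"
    using h ih by (intro integral_mono) auto
  then have hN: "(\<integral>x. h x \<partial>N) \<le> 3 * measure N (space N)" by simp
  have "(\<integral>x. h x * s x \<partial>M) - (\<integral>x. s x \<partial>M) = (\<integral>x. (h x - 1) * s x \<partial>M)"
    using ih by (simp add: algebra_simps)
  also have "\<dots> \<le> (\<integral>x. ((g x)\<^sup>2 - (f x)\<^sup>2) / 4 + 2 * (sqrt (s x) - f x)\<^sup>2 - (f x - g x)\<^sup>2 / 4 \<partial>M)"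
  proof (rule integral_mono_AE)
    show "AE x in M. (h x - 1) * s x \<le> ((g x)\<^sup>2 - (f x)\<^sup>2) / 4 + 2 * (sqrt (s x) - f x)\<^sup>2 - (f x - g x)\<^sup>2 / 4"
      using s_nonneg
    proof eventually_elim
      case (elim x)
      then show ?case
        using log_ratio_inequality[of "f x" "g x" "sqrt (s x)"] f g by (simp add: h_def)
    qed
    show "integrable M (\<lambda>x. (h x - 1) * s x)"
      using ih by (simp add: algebra_simps)
  qed (use i in auto)
  also have "\<dots> = c + 2 * (\<integral>x. (sqrt (s x) - f x)\<^sup>2 \<partial>M) - (\<integral>x. (f x - g x)\<^sup>2 \<partial>M) / 4"
    using i by (simp add: c_def)
  finally have le: "(\<integral>x. h x \<partial>mean) - measure mean (space mean) - c
      \<le> 2 * err f - (\<integral>x. (f x - g x)\<^sup>2 \<partial>M) / 4"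
    using hN unfolding ih(4) measure_mean err_def by simp
  have cm: "(\<lambda>x. log_ratio (f x) (g x)) \<in> borel_measurable mean"
    by (simp cong: measurable_cong_sets)
  have cc: "sets (poisson_process mean) = sets (configurations mean)"
    using finite_measure_mean by (rule prob_space_poisson_process)
  have "(\<integral>\<^sup>+X. ennreal (exp (score M f g X)) \<partial>poisson_process mean)
     = (\<integral>\<^sup>+X. ennreal (exp (- c)) * ennreal (exp (\<Sum>x\<in>#X. log_ratio (f x) (g x))) \<partial>poisson_process mean)"
    by (simp add: score_def c_def flip: ennreal_mult exp_add)
  also have "\<dots> = ennreal (exp (- c)) * (\<integral>\<^sup>+X. ennreal (exp (\<Sum>x\<in>#X. log_ratio (f x) (g x))) \<partial>poisson_process mean)"
    using borel_measurable_sum_mset_configurations[OF cm] cc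
    by (intro nn_integral_cmult) (simp cong: measurable_cong_sets)
  also have "\<dots> = ennreal (exp (- c)) * ennreal (exp ((\<integral>x. h x \<partial>mean) - measure mean (space mean)))"
    using ih(1) cm finite_measure_mean
    by (subst nn_integral_exp_sum_poisson_process) (auto simp: h_def[symmetric])
  also have "\<dots> = ennreal (exp ((\<integral>x. h x \<partial>mean) - measure mean (space mean) - c))"
    by (simp flip: ennreal_mult exp_add)
  finally show ?thesis using le by (simp add: ennreal_leI)
qed

end

section \<open>Hellinger loss of a density estimator\<close>

lemma hellinger_nonneg: "0 \<le> hellinger \<mu> \<nu>"
  by (simp add: hellinger_def hellinger_sq_def Let_def)

context mean_measure
begin

text \<open>
  By orthogonality, \<open>M + N\<close> dominates both measures, with densities that are \<open>s\<close> and \<open>f\<^sup>2\<close> on the part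
  carrying \<open>M\<close>, and \<open>1\<close> and \<open>0\<close> on the part carrying \<open>N\<close>.
\<close>

lemma hellinger_le_err:
  assumes orth: "orthogonal_measures N M" and f: "f \<in> L2_space M" "\<And>x. 0 \<le> f x"
  shows "hellinger mean (weighted (\<lambda>x. (f x)\<^sup>2) M) \<le> sqrt (err f)"
proof -
  have [measurable]: "f \<in> borel_measurable M" and f2: "integrable M (\<lambda>x. (f x)\<^sup>2)"
    using f(1) by (auto dest: L2_spaceD)
  obtain A where A: "A \<in> sets N" "emeasure N A = 0" "emeasure M (space M - A) = 0"
    using orth by (auto simp: orthogonal_measures_def)
  have A_M [measurable]: "A \<in> sets M" using A sets_N by simp
  have aeM: "AE x in M. x \<in> A"
    using A(3) A_M by (intro AE_I[of _ _ "space M - A"]) auto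
  have aeN: "AE x in N. x \<notin> A"
    using A by (intro AE_I[of _ _ A]) auto
  define \<nu> where "\<nu> = measure_add M N"
  have [measurable_cong]: "sets \<nu> = sets M" by (simp add: \<nu>_def)
  have \<nu>: "(\<integral>\<^sup>+x. h x \<partial>\<nu>) = (\<integral>\<^sup>+x. h x \<partial>M) + (\<integral>\<^sup>+x. h x \<partial>N)" if "h \<in> borel_measurable M" for h
    unfolding \<nu>_def using that by (intro nn_integral_measure_add) (simp add: sets_N)
  \<comment> \<open>The truncation makes the density nonnegative everywhere and not only almost everywhere.\<close>
  define a where "a x = (if x \<in> A then max 0 (s x) else 1)" for x
  define b where "b x = (if x \<in> A then (f x)\<^sup>2 else 0)" for x
  have [measurable]: "a \<in> borel_measurable M" "b \<in> borel_measurable M"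
    unfolding a_def[abs_def] b_def[abs_def] by measurable
  have a: "density \<nu> a = mean"
  proof (rule measure_eqI)
    fix B assume "B \<in> sets (density \<nu> a)"
    then have B [measurable]: "B \<in> sets M" by (simp add: \<nu>_def)
    have "emeasure (density \<nu> a) B
       = (\<integral>\<^sup>+x. ennreal (a x) * indicator B x \<partial>M) + (\<integral>\<^sup>+x. ennreal (a x) * indicator B x \<partial>N)"
      by (simp add: emeasure_density \<nu>)
    also have "(\<integral>\<^sup>+x. ennreal (a x) * indicator B x \<partial>M) = (\<integral>\<^sup>+x. ennreal (s x) * indicator B x \<partial>M)"
      using aeM s_nonneg by (intro nn_integral_cong_AE) (auto simp: a_def)
    also have "(\<integral>\<^sup>+x. ennreal (a x) * indicator B x \<partial>N) = (\<integral>\<^sup>+x. indicator B x \<partial>N)"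
      using aeN by (intro nn_integral_cong_AE) (auto simp: a_def)
    finally show "emeasure (density \<nu> a) B = emeasure mean B"
      using sets_N by (simp add: emeasure_measure_add emeasure_density)
  qed (simp add: \<nu>_def)
  have b: "density \<nu> b = weighted (\<lambda>x. (f x)\<^sup>2) M"
  proof (rule measure_eqI)
    fix B assume "B \<in> sets (density \<nu> b)"
    then have B [measurable]: "B \<in> sets M" by (simp add: \<nu>_def)
    have "emeasure (density \<nu> b) B
       = (\<integral>\<^sup>+x. ennreal (b x) * indicator B x \<partial>M) + (\<integral>\<^sup>+x. ennreal (b x) * indicator B x \<partial>N)"
      by (simp add: emeasure_density \<nu>)
    also have "(\<integral>\<^sup>+x. ennreal (b x) * indicator B x \<partial>M) = (\<integral>\<^sup>+x. ennreal ((f x)\<^sup>2) * indicator B x \<partial>M)"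
      using aeM by (intro nn_integral_cong_AE) (auto simp: b_def)
    also have "(\<integral>\<^sup>+x. ennreal (b x) * indicator B x \<partial>N) = (\<integral>\<^sup>+x. 0 \<partial>N)"
      using aeN by (intro nn_integral_cong_AE) (auto simp: b_def)
    finally show "emeasure (density \<nu> b) B = emeasure (weighted (\<lambda>x. (f x)\<^sup>2) M) B"
      by (simp add: emeasure_density)
  qed (simp add: \<nu>_def)
  have fin: "finite_measure (weighted (\<lambda>x. (f x)\<^sup>2) M)"
    using f2 by (auto intro!: finite_measureI simp: emeasure_density nn_integral_eq_integral
        cong: nn_integral_cong)
  have "hellinger_sq mean (weighted (\<lambda>x. (f x)\<^sup>2) M) = 1 / 2 * (\<integral>x. (sqrt (a x) - sqrt (b x))\<^sup>2 \<partial>\<nu>)"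
    unfolding a[symmetric] b[symmetric]
  proof (rule hellinger_dominated)
    show "finite_measure (density \<nu> a)" "finite_measure (density \<nu> b)"
      unfolding a b by (rule finite_measure_mean fin)+
  qed (auto simp: a_def b_def)
  also have "(\<integral>x. (sqrt (a x) - sqrt (b x))\<^sup>2 \<partial>\<nu>) = enn2real (\<integral>\<^sup>+x. ennreal ((sqrt (a x) - sqrt (b x))\<^sup>2) \<partial>\<nu>)"
    by (rule integral_eq_nn_integral) auto
  also have "(\<integral>\<^sup>+x. ennreal ((sqrt (a x) - sqrt (b x))\<^sup>2) \<partial>\<nu>)
     = (\<integral>\<^sup>+x. ennreal ((sqrt (a x) - sqrt (b x))\<^sup>2) \<partial>M) + (\<integral>\<^sup>+x. ennreal ((sqrt (a x) - sqrt (b x))\<^sup>2) \<partial>N)"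
    by (rule \<nu>) measurable
  also have "(\<integral>\<^sup>+x. ennreal ((sqrt (a x) - sqrt (b x))\<^sup>2) \<partial>M) = (\<integral>\<^sup>+x. ennreal ((sqrt (s x) - f x)\<^sup>2) \<partial>M)"
    using aeM s_nonneg f(2) by (intro nn_integral_cong_AE) (auto simp: a_def b_def)
  also have "\<dots> = ennreal (\<integral>x. (sqrt (s x) - f x)\<^sup>2 \<partial>M)"
    using L2_spaceD[OF L2_space_diff[OF sqrt_L1_nonneg[OF s] f(1)]]
    by (intro nn_integral_eq_integral) auto
  also have "(\<integral>\<^sup>+x. ennreal ((sqrt (a x) - sqrt (b x))\<^sup>2) \<partial>N) = (\<integral>\<^sup>+x. 1 \<partial>N)"
    using aeN by (intro nn_integral_cong_AE) (auto simp: a_def b_def)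
  also have "\<dots> = ennreal (measure N (space N))"
    using finite_measure.emeasure_eq_measure[OF finite_N] by simp
  finally have "hellinger_sq mean (weighted (\<lambda>x. (f x)\<^sup>2) M) = 1 / 2 * err f"
    by (simp add: err_def flip: ennreal_plus)
  then show ?thesis
    using err_nonneg[of f] by (simp add: hellinger_def)
qed

end

section \<open>Selection among countably many candidates\<close>

text \<open>
  Lets one random variable with a finite mean bound all moments of its logarithm.
\<close>

lemma powr_one_plus_ln_le:
  fixes q v :: real
  assumes "1 \<le> q" "1 \<le> v"
  shows "(1 + ln v) powr (q / 2) \<le> q powr (q / 2) * v"
proof -
  have "1 + ln v \<le> q * (1 + ln v / q)"
    using assms by (simp add: distrib_left)
  also have "\<dots> \<le> q * exp (ln v / q)"
    using assms by (intro mult_left_mono exp_ge_add_one_self) auto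
  finally have "(1 + ln v) powr (q / 2) \<le> (q * exp (ln v / q)) powr (q / 2)"
    using assms by (intro powr_mono2) auto
  also have "(q * exp (ln v / q)) powr (q / 2) = q powr (q / 2) * exp (ln v / q) powr (q / 2)"
    by (rule powr_mult)
  also have "exp (ln v / q) powr (q / 2) = exp (ln v / 2)"
    using assms by (simp add: powr_def)
  finally have "(1 + ln v) powr (q / 2) \<le> q powr (q / 2) * exp (ln v / 2)" .
  also have "\<dots> \<le> q powr (q / 2) * exp (ln v)"
    by (intro mult_left_mono, subst exp_le_cancel_iff) (use assms in auto)
  finally show ?thesis using assms by simp
qed

locale candidate_family =
  fixes M :: "'a measure" and J :: "'j set" and t :: "'j \<Rightarrow> 'a \<Rightarrow> real" and w :: "'j \<Rightarrow> real"
  assumes countable_J: "countable J" and J_nonempty: "J \<noteq> {}"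
    and t_L2: "\<And>j. j \<in> J \<Longrightarrow> t j \<in> L2_space M" and t_nonneg: "\<And>j x. 0 \<le> t j x"
begin

text \<open>
  The worst penalised score that a competitor reaches against \<open>j\<close>. It may be infinite, as infinitely many
  candidates compete.
\<close>

definition crit :: "'j \<Rightarrow> 'a multiset \<Rightarrow> ereal" where
  "crit j X = (SUP i\<in>J. ereal (score M (t j) (t i) X - w i + w j))"

lemma crit_ge: "i \<in> J \<Longrightarrow> ereal (score M (t j) (t i) X - w i + w j) \<le> crit j X"
  unfolding crit_def by (rule SUP_upper)

lemma crit_nonneg: "j \<in> J \<Longrightarrow> 0 \<le> crit j X"
  using crit_ge[of j j X] by (simp add: zero_ereal_def)

lemma measurable_crit:
  assumes "j \<in> J"
  shows "crit j \<in> borel_measurable (configurations M)"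
  unfolding crit_def[abs_def]
proof (rule borel_measurable_SUP[OF countable_J])
  fix i assume "i \<in> J"
  then have [measurable]: "t i \<in> borel_measurable M" "t j \<in> borel_measurable M"
    using assms t_L2[THEN L2_spaceD(1)] by auto
  have [measurable]: "score M (t j) (t i) \<in> borel_measurable (configurations M)"
    by (rule measurable_score) measurable
  show "(\<lambda>X. ereal (score M (t j) (t i) X - w i + w j)) \<in> borel_measurable (configurations M)"
    by measurable
qed

text \<open>
  Exact minimisers of the criterion need not exist; the first near-minimiser in an enumeration exists as soon as
  the criterion is finite somewhere, and depends measurably on the configuration.
\<close>

definition index :: "'a multiset \<Rightarrow> nat" where
  "index X = (LEAST n. \<forall>i\<in>J. crit (from_nat_into J n) X \<le> crit i X + 1)"

definition selected :: "'a multiset \<Rightarrow> 'j" where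
  "selected X = from_nat_into J (index X)"

lemma selected_in: "selected X \<in> J"
  unfolding selected_def by (rule from_nat_into[OF J_nonempty])

lemma selected_crit:
  assumes "i \<in> J" "crit i X < \<infinity>"
  shows "crit (selected X) X \<le> crit i X + 1"
proof -
  define c where "c = (INF j\<in>J. crit j X)"
  have c: "c \<le> crit j X" if "j \<in> J" for j unfolding c_def using that by (rule INF_lower)
  have "0 \<le> c" unfolding c_def by (intro INF_greatest crit_nonneg)
  moreover have "c < \<infinity>" using c[OF assms(1)] assms(2) by (rule le_less_trans)
  ultimately have "c < c + 1" by (cases c) auto
  then obtain j where j: "j \<in> J" "crit j X < c + 1"
    by (subst (asm) (1) c_def) (auto simp: INF_less_iff)
  obtain n where "from_nat_into J n = j"
    using from_nat_into_surj[OF countable_J j(1)] by auto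
  moreover have "crit j X \<le> crit i X + 1" if "i \<in> J" for i
    using j(2) c[OF that] by (meson add_right_mono less_imp_le order_trans)
  ultimately have "\<exists>n. \<forall>i\<in>J. crit (from_nat_into J n) X \<le> crit i X + 1" by auto
  then have "\<forall>i\<in>J. crit (from_nat_into J (index X)) X \<le> crit i X + 1"
    unfolding index_def by (rule LeastI_ex)
  then show ?thesis using assms by (simp add: selected_def)
qed

lemma measurable_index: "index \<in> configurations M \<rightarrow>\<^sub>M count_space UNIV"
  unfolding index_def[abs_def]
proof (rule measurable_Least)
  fix n
  have [measurable]: "crit (from_nat_into J n) \<in> borel_measurable (configurations M)"
    by (intro measurable_crit from_nat_into J_nonempty)
  have "{X \<in> space (configurations M). \<forall>i\<in>J. crit (from_nat_into J n) X \<le> crit i X + 1} \<in> sets (configurations M)"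
  proof (rule sets.sets_Collect_countable_All'[OF _ countable_J])
    fix i assume "i \<in> J"
    then have [measurable]: "crit i \<in> borel_measurable (configurations M)" by (rule measurable_crit)
    show "{X \<in> space (configurations M). crit (from_nat_into J n) X \<le> crit i X + 1} \<in> sets (configurations M)"
      by measurable
  qed
  then show "Measurable.pred (configurations M) (\<lambda>X. \<forall>i\<in>J. crit (from_nat_into J n) X \<le> crit i X + 1)"
    by (simp add: pred_def)
qed

lemma square_L1: "j \<in> J \<Longrightarrow> (\<lambda>x. (t j x)\<^sup>2) \<in> L1_nonneg M"
  using t_L2[of j] by (auto simp: L1_nonneg_def L2_space_def)

text \<open>
  The estimator takes countably many values and factors through an index with values in a discrete space, so
  it is measurable for every \<open>\<sigma>\<close>-algebra on its range.
\<close>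

lemma density_estimator_selected: "density_estimator M (\<lambda>X x. (t (selected X) x)\<^sup>2)"
  unfolding density_estimator_def
proof (intro conjI ballI)
  show "(\<lambda>x. (t (selected X) x)\<^sup>2) \<in> L1_nonneg M" for X
    by (rule square_L1[OF selected_in])
  have "(\<lambda>n. weighted (\<lambda>x. (t (from_nat_into J n) x)\<^sup>2) M) \<in> count_space UNIV \<rightarrow>\<^sub>M Q_dom_borel M"
    using square_L1[OF from_nat_into[OF J_nonempty]]
    by (auto simp: Q_dom_borel_def Q_dom_def space_measure_of_conv)
  from measurable_compose[OF measurable_index this]
  show "(\<lambda>X. weighted (\<lambda>x. (t (selected X) x)\<^sup>2) M) \<in> configurations M \<rightarrow>\<^sub>M Q_dom_borel M"
    by (simp add: selected_def)
qed

text \<open>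
  The bound \<open>Z\<close> makes the criterion at \<open>i\<close> small. The selected candidate then has a small criterion too, so
  \<open>i\<close> has no large score against it; by antisymmetry it has no very negative score against \<open>i\<close>, whereas \<open>Z\<close>
  forces its score to be very negative when it is far from \<open>i\<close>.
\<close>

lemma selected_close:
  assumes i: "i \<in> J"
    and Z: "\<And>j. j \<in> J \<Longrightarrow> exp (score M (t i) (t j) X - a + (\<integral>x. (t i x - t j x)\<^sup>2 \<partial>M) / 8 - w j) \<le> Z"
  shows "(\<integral>x. (t i x - t (selected X) x)\<^sup>2 \<partial>M) / 8 \<le> 2 * a + 2 * w i + 2 * ln (1 + Z) + 1"
proof -
  define d where "d j = (\<integral>x. (t i x - t j x)\<^sup>2 \<partial>M)" for j
  have d: "0 \<le> d j" for j by (simp add: d_def)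
  have sc: "score M (t i) (t j) X \<le> a - d j / 8 + w j + ln (1 + Z)" if "j \<in> J" for j
  proof -
    have "exp (score M (t i) (t j) X - a + d j / 8 - w j) \<le> 1 + Z"
      using Z[OF that] by (simp add: d_def)
    moreover have "0 < 1 + Z"
      using calculation exp_gt_zero less_le_trans by blast
    ultimately have "score M (t i) (t j) X - a + d j / 8 - w j \<le> ln (1 + Z)"
      by (simp add: ln_ge_iff)
    then show ?thesis by simp
  qed
  have up: "crit i X \<le> ereal (a + ln (1 + Z) + w i)"
    unfolding crit_def
  proof (rule SUP_least)
    fix j assume "j \<in> J"
    from sc[OF this] d[of j] show "ereal (score M (t i) (t j) X - w j + w i) \<le> ereal (a + ln (1 + Z) + w i)"
      by simp
  qed
  have "ereal (score M (t (selected X)) (t i) X - w i + w (selected X)) \<le> crit (selected X) X"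
    using i by (rule crit_ge)
  also have "\<dots> \<le> crit i X + 1"
    using i up by (intro selected_crit) auto
  also have "\<dots> \<le> ereal (a + ln (1 + Z) + w i) + 1"
    using up by (rule add_right_mono)
  finally have "score M (t (selected X)) (t i) X - w i + w (selected X) \<le> a + ln (1 + Z) + w i + 1"
    by (simp add: one_ereal_def)
  then show ?thesis
    using sc[OF selected_in[of X]] unfolding score_swap[of M "t (selected X)"] d_def by linarith
qed

text \<open>
  Here \<open>i\<close> is any candidate that is good for the unknown mean measure; the selection does not involve it. The
  series \<open>Z\<close> of exponential scores against \<open>i\<close> turns the deterministic bound above into a bound in mean.
\<close>

lemma selected_risk:
  assumes "mean_measure M s N" and orth: "orthogonal_measures N M"
    and i: "i \<in> J" and \<rho>: "1 \<le> \<rho>" "mean_measure.err M s N (t i) \<le> \<rho>" "w i \<le> \<rho>"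
    and B: "(\<integral>\<^sup>+j. ennreal (exp (- (\<integral>x. (t i x - t j x)\<^sup>2 \<partial>M) / 8 - w j)) \<partial>count_space J) \<le> ennreal B" "0 \<le> B"
    and q: "1 \<le> q"
  shows "(\<integral>\<^sup>+X. ennreal (hellinger (measure_add (weighted s M) N)
        (weighted (\<lambda>x. (t (selected X) x)\<^sup>2) M) powr q) \<partial>poisson_process (measure_add (weighted s M) N))
     \<le> ennreal ((114 * q * \<rho>) powr (q / 2) * (1 + B))"
proof -
  interpret mean_measure M s N by fact
  define a where "a = 2 * err (t i)"
  define d where "d j = (\<integral>x. (t i x - t j x)\<^sup>2 \<partial>M)" for j
  define gain where "gain j X = ennreal (exp (score M (t i) (t j) X - a + d j / 8 - w j))" for j X
  define Z where "Z X = (\<integral>\<^sup>+j. gain j X \<partial>count_space J)" for X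
  define c where "c = (114 * q * \<rho>) powr (q / 2)"
  have c: "c > 0" using q \<rho> by (simp add: c_def)
  let ?H = "\<lambda>X. hellinger mean (weighted (\<lambda>x. (t (selected X) x)\<^sup>2) M)"
  let ?P = "poisson_process mean"
  \<comment> \<open>Where \<open>Z\<close> is infinite the bound is trivial; elsewhere all exponential scores are at most \<open>Z\<close>.\<close>
  have pointwise: "ennreal (?H X powr q) \<le> ennreal c * (1 + Z X)" for X
  proof (cases "Z X")
    case top
    then show ?thesis using c by (simp add: ennreal_mult_top)
  next
    case (real z)
    have "exp (score M (t i) (t j) X - a + d j / 8 - w j) \<le> z" if "j \<in> J" for j
    proof -
      have "gain j X \<le> Z X" unfolding Z_def using that by (rule nn_integral_ge_point)
      then show ?thesis using real by (simp add: gain_def)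
    qed
    then have close: "d (selected X) / 8 \<le> 2 * a + 2 * w i + 2 * ln (1 + z) + 1"
      unfolding d_def by (rule selected_close[OF i])
    define y where "y = ln (1 + z)"
    have y: "0 \<le> y" using real by (simp add: y_def)
    let ?t = "t (selected X)"
    have L2: "(\<lambda>x. sqrt (s x) - t i x) \<in> L2_space M" "(\<lambda>x. t i x - ?t x) \<in> L2_space M"
      by (intro L2_space_diff sqrt_L1_nonneg s t_L2 i selected_in)+
    have "err ?t \<le> 2 * err (t i) + 2 * d (selected X)"
    proof -
      have "0 \<le> measure N (space N)" by simp
      then show ?thesis
        using integral_square_triangle[OF L2] unfolding err_def d_def distrib_left by linarith
    qed
    \<comment> \<open>From \<open>a \<le> 2\<rho>\<close>, \<open>w i \<le> \<rho>\<close> and \<open>1 \<le> \<rho>\<close> the squared distance to \<open>t i\<close> is at most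
      \<open>56 \<rho> + 16 y\<close>; then \<open>2 \<rho> + 2 (56 \<rho> + 16 y)\<close> bounds the error.\<close>
    also have "\<dots> \<le> 114 * \<rho> + 32 * y"
      using close \<rho> unfolding a_def y_def by linarith
    also have "\<dots> \<le> 114 * \<rho> * (1 + y)"
      using \<rho> y mult_right_mono[of 1 \<rho> y] by (simp add: algebra_simps)
    finally have err: "err ?t \<le> 114 * \<rho> * (1 + y)" .
    have "?H X \<le> sqrt (err ?t)"
      by (intro hellinger_le_err orth t_L2 selected_in t_nonneg)
    also have "\<dots> \<le> sqrt (114 * \<rho> * (1 + y))"
      using err by (rule real_sqrt_le_mono)
    finally have "?H X powr q \<le> sqrt (114 * \<rho> * (1 + y)) powr q"
      using q hellinger_nonneg by (intro powr_mono2) auto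
    also have "\<dots> = (114 * \<rho>) powr (q / 2) * (1 + y) powr (q / 2)"
      using \<rho> y by (simp add: powr_half_sqrt[symmetric] powr_powr powr_mult)
    also have "\<dots> \<le> (114 * \<rho>) powr (q / 2) * (q powr (q / 2) * (1 + z))"
      unfolding y_def using q real by (intro mult_left_mono powr_one_plus_ln_le) auto
    also have "\<dots> = c * (1 + z)"
      using q \<rho> by (simp add: c_def powr_mult)
    finally have "ennreal (?H X powr q) \<le> ennreal (c * (1 + z))" by (rule ennreal_leI)
    also have "\<dots> = ennreal c * (1 + Z X)"
      using real c by (simp add: ennreal_mult ennreal_plus)
    finally show ?thesis .
  qed
  interpret P: prob_space ?P
    by (rule prob_space_poisson_process(1)[OF finite_measure_mean])
  have sets_P: "sets ?P = sets (configurations M)"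
    using prob_space_poisson_process(2)[OF finite_measure_mean] configurations_cong[of mean M] by simp
  have score_m: "score M (t i) (t j) \<in> borel_measurable ?P" if "j \<in> J" for j
    unfolding measurable_cong_sets[OF sets_P refl]
    by (intro measurable_score L2_spaceD(1) t_L2 i that)
  have gain_m: "gain j \<in> borel_measurable ?P" if "j \<in> J" for j
  proof -
    note [measurable] = score_m[OF that]
    show ?thesis unfolding gain_def by measurable
  qed
  have gain_pair: "case_prod gain \<in> borel_measurable (count_space J \<Otimes>\<^sub>M ?P)"
    using gain_m by (intro measurable_pair_measure_countable1 countable_J) simp
  have fubini: "pair_sigma_finite (count_space J) ?P"
    by (intro pair_sigma_finite.intro sigma_finite_measure_count_space_countable countable_J
        P.sigma_finite_measure_axioms)
  have "(\<integral>\<^sup>+X. Z X \<partial>?P) = (\<integral>\<^sup>+j. \<integral>\<^sup>+X. gain j X \<partial>?P \<partial>count_space J)"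
    unfolding Z_def using gain_pair by (rule pair_sigma_finite.Fubini'[OF fubini])
  also have "\<dots> \<le> (\<integral>\<^sup>+j. ennreal (exp (- d j / 8 - w j)) \<partial>count_space J)"
  proof (rule nn_integral_mono)
    fix j assume "j \<in> space (count_space J)"
    then have j: "j \<in> J" by simp
    have "(\<integral>\<^sup>+X. gain j X \<partial>?P)
      = (\<integral>\<^sup>+X. ennreal (exp (- a + d j / 8 - w j)) * ennreal (exp (score M (t i) (t j) X)) \<partial>?P)"
      unfolding gain_def by (simp add: algebra_simps flip: ennreal_mult exp_add)
    also have "\<dots> = ennreal (exp (- a + d j / 8 - w j)) * (\<integral>\<^sup>+X. ennreal (exp (score M (t i) (t j) X)) \<partial>?P)"
      by (rule nn_integral_cmult) (use score_m[OF j] in measurable)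
    also have "\<dots> \<le> ennreal (exp (- a + d j / 8 - w j)) * ennreal (exp (a - d j / 4))"
      unfolding a_def d_def by (intro mult_left_mono exp_score_moment t_L2 t_nonneg i j) simp
    also have "\<dots> = ennreal (exp (- d j / 8 - w j))"
      by (simp flip: ennreal_mult exp_add)
    finally show "(\<integral>\<^sup>+X. gain j X \<partial>?P) \<le> ennreal (exp (- d j / 8 - w j))" .
  qed
  also have "\<dots> \<le> ennreal B" using B(1) by (simp add: d_def)
  finally have Z: "(\<integral>\<^sup>+X. Z X \<partial>?P) \<le> ennreal B" .
  have Z_m: "Z \<in> borel_measurable ?P"
    unfolding Z_def[abs_def]
    using sigma_finite_measure.borel_measurable_nn_integral[OF
        sigma_finite_measure_count_space_countable[OF countable_J], of "\<lambda>X j. gain j X" ?P]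
      measurable_pair_swap[OF gain_pair] by (simp add: case_prod_unfold)
  have "(\<integral>\<^sup>+X. ennreal (?H X powr q) \<partial>?P) \<le> (\<integral>\<^sup>+X. ennreal c * (1 + Z X) \<partial>?P)"
    by (intro nn_integral_mono pointwise)
  also have "\<dots> = ennreal c * (1 + (\<integral>\<^sup>+X. Z X \<partial>?P))"
    using Z_m by (simp add: nn_integral_cmult nn_integral_add P.emeasure_space_1)
  also have "\<dots> \<le> ennreal c * (1 + ennreal B)"
    by (intro mult_left_mono add_left_mono Z) simp
  also have "\<dots> = ennreal (c * (1 + B))"
    using c B(2) by (simp add: ennreal_mult ennreal_plus)
  finally show ?thesis unfolding c_def .
qed

end

section \<open>Orthonormal systems and Gaussian sums over lattices\<close>

definition orthonormal :: "'a measure \<Rightarrow> (nat \<Rightarrow> 'a \<Rightarrow> real) \<Rightarrow> nat \<Rightarrow> bool" where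
  "orthonormal M e d \<longleftrightarrow> (\<forall>i<d. e i \<in> L2_space M) \<and>
     (\<forall>i<d. \<forall>j<d. (\<integral>x. e i x * e j x \<partial>M) = (if i = j then 1 else 0))"

lemma orthonormalD:
  assumes "orthonormal M e d"
  shows "i < d \<Longrightarrow> e i \<in> L2_space M"
    and "i < d \<Longrightarrow> j < d \<Longrightarrow> (\<integral>x. e i x * e j x \<partial>M) = (if i = j then 1 else 0)"
  using assms by (auto simp: orthonormal_def)

lemma orthonormal_combination_L2:
  "orthonormal M e d \<Longrightarrow> (\<lambda>x. \<Sum>i<d. c i * e i x) \<in> L2_space M"
  by (intro L2_space_sum L2_space_cmult) (auto dest: orthonormalD)

lemma integral_mult_combination:
  assumes "orthonormal M e d" "g \<in> L2_space M"
  shows "(\<integral>x. g x * (\<Sum>i<d. c i * e i x) \<partial>M) = (\<Sum>i<d. c i * (\<integral>x. g x * e i x \<partial>M))"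
proof -
  have "(\<integral>x. g x * (\<Sum>i<d. c i * e i x) \<partial>M) = (\<integral>x. (\<Sum>i<d. c i * (g x * e i x)) \<partial>M)"
    by (simp add: sum_distrib_left mult.left_commute)
  also have "\<dots> = (\<Sum>i<d. \<integral>x. c i * (g x * e i x) \<partial>M)"
    using assms by (intro Bochner_Integration.integral_sum integrable_mult_right L2_space_integrable_mult)
      (auto dest: orthonormalD)
  finally show ?thesis by simp
qed

lemma integral_combination_mult:
  assumes "orthonormal M e d" "j < d"
  shows "(\<integral>x. (\<Sum>i<d. c i * e i x) * e j x \<partial>M) = c j"
proof -
  have "(\<integral>x. (\<Sum>i<d. c i * e i x) * e j x \<partial>M) = (\<Sum>i<d. c i * (\<integral>x. e j x * e i x \<partial>M))"
    using integral_mult_combination[OF assms(1) orthonormalD(1)[OF assms]] by (simp add: mult.commute)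
  also have "\<dots> = (\<Sum>i<d. if i = j then c i else 0)"
    using assms by (intro sum.cong) (auto simp: orthonormalD)
  finally show ?thesis using assms by simp
qed

lemma integral_combination_square:
  assumes "orthonormal M e d"
  shows "(\<integral>x. (\<Sum>i<d. c i * e i x)\<^sup>2 \<partial>M) = (\<Sum>i<d. (c i)\<^sup>2)"
  using integral_mult_combination[OF assms orthonormal_combination_L2[OF assms]]
  by (simp add: power2_eq_square integral_combination_mult[OF assms])

lemma integral_residual_mult:
  assumes "orthonormal M e d" "f \<in> L2_space M" "j < d"
  shows "(\<integral>x. (f x - (\<Sum>i<d. (\<integral>y. f y * e i y \<partial>M) * e i x)) * e j x \<partial>M) = 0"
proof -
  have "integrable M (\<lambda>x. f x * e j x)"
    "integrable M (\<lambda>x. (\<Sum>i<d. (\<integral>y. f y * e i y \<partial>M) * e i x) * e j x)"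
    using assms by (auto intro!: L2_space_integrable_mult orthonormal_combination_L2 dest: orthonormalD)
  then show ?thesis
    using integral_combination_mult[OF assms(1,3)] by (simp add: left_diff_distrib)
qed

lemma bessel_inequality:
  assumes o: "orthonormal M e d" and f: "f \<in> L2_space M"
  shows "(\<Sum>i<d. (c i - (\<integral>x. f x * e i x \<partial>M))\<^sup>2) \<le> (\<integral>x. (f x - (\<Sum>i<d. c i * e i x))\<^sup>2 \<partial>M)"
proof -
  define a where "a i = (\<integral>x. f x * e i x \<partial>M)" for i
  define p where "p x = f x - (\<Sum>i<d. a i * e i x)" for x
  define r where "r x = (\<Sum>i<d. (a i - c i) * e i x)" for x
  have p: "p \<in> L2_space M" and r: "r \<in> L2_space M"
    unfolding p_def r_def by (intro L2_space_diff f orthonormal_combination_L2 o)+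
  have "(\<integral>x. p x * r x \<partial>M) = (\<Sum>i<d. (a i - c i) * (\<integral>x. p x * e i x \<partial>M))"
    unfolding r_def by (rule integral_mult_combination[OF o p])
  also have "\<dots> = 0"
    unfolding p_def a_def using integral_residual_mult[OF o f] by simp
  finally have pr: "(\<integral>x. p x * r x \<partial>M) = 0" .
  have "f x - (\<Sum>i<d. c i * e i x) = p x + r x" for x
    by (simp add: p_def r_def left_diff_distrib sum_subtractf)
  then have "(\<integral>x. (f x - (\<Sum>i<d. c i * e i x))\<^sup>2 \<partial>M) = (\<integral>x. (p x)\<^sup>2 + (r x)\<^sup>2 + 2 * (p x * r x) \<partial>M)"
    by (simp add: power2_sum mult.assoc)
  also have "\<dots> = (\<integral>x. (p x)\<^sup>2 \<partial>M) + (\<integral>x. (r x)\<^sup>2 \<partial>M)"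
    using L2_spaceD(2)[OF p] L2_spaceD(2)[OF r] L2_space_integrable_mult[OF p r] by (simp add: pr)
  also have "(\<integral>x. (r x)\<^sup>2 \<partial>M) = (\<Sum>i<d. (a i - c i)\<^sup>2)"
    unfolding r_def by (rule integral_combination_square[OF o])
  also have "\<dots> = (\<Sum>i<d. (c i - a i)\<^sup>2)"
    by (simp add: power2_commute)
  finally have "(\<integral>x. (f x - (\<Sum>i<d. c i * e i x))\<^sup>2 \<partial>M) = (\<integral>x. (p x)\<^sup>2 \<partial>M) + (\<Sum>i<d. (c i - a i)\<^sup>2)" .
  moreover have "0 \<le> (\<integral>x. (p x)\<^sup>2 \<partial>M)" by simp
  ultimately have "(\<Sum>i<d. (c i - a i)\<^sup>2) \<le> (\<integral>x. (f x - (\<Sum>i<d. c i * e i x))\<^sup>2 \<partial>M)"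
    by linarith
  then show ?thesis unfolding a_def .
qed

text \<open>
  Gram-Schmidt orthonormalisation modulo null functions. A function that depends on its predecessors almost
  everywhere has a null residual and is skipped, hence \<open>d \<le> D\<close>.
\<close>

lemma gram_schmidt:
  assumes "\<And>i. i < D \<Longrightarrow> \<phi> i \<in> L2_space M"
  shows "\<exists>e d. d \<le> D \<and> orthonormal M e d \<and> (\<forall>i<D. \<exists>c. AE x in M. \<phi> i x = (\<Sum>j<d. c j * e j x))"
  using assms
proof (induction D)
  case 0
  then show ?case by (auto simp: orthonormal_def)
next
  case (Suc D)
  then obtain e d where d: "d \<le> D" and o: "orthonormal M e d"
    and span: "\<And>i. i < D \<Longrightarrow> \<exists>c. AE x in M. \<phi> i x = (\<Sum>j<d. c j * e j x)"
    by (metis less_Suc_eq)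
  define a where "a i = (\<integral>x. \<phi> D x * e i x \<partial>M)" for i
  define r where "r x = \<phi> D x - (\<Sum>j<d. a j * e j x)" for x
  have r: "r \<in> L2_space M"
    unfolding r_def using Suc.prems by (intro L2_space_diff orthonormal_combination_L2 o) auto
  have re: "(\<integral>x. r x * e j x \<partial>M) = 0" if "j < d" for j
    unfolding r_def a_def using Suc.prems that by (intro integral_residual_mult o) auto
  define n where "n = (\<integral>x. (r x)\<^sup>2 \<partial>M)"
  show ?case
  proof (cases "n = 0")
    case True
    then have "AE x in M. (r x)\<^sup>2 = 0"
      using L2_spaceD[OF r] by (subst integral_nonneg_eq_0_iff_AE[symmetric]) (auto simp: n_def)
    then have "AE x in M. \<phi> D x = (\<Sum>j<d. a j * e j x)"
      by eventually_elim (simp add: r_def)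
    then show ?thesis
      using d o span by (intro exI[of _ e] exI[of _ d]) (auto simp: less_Suc_eq)
  next
    case False
    then have n: "n > 0" by (simp add: n_def less_le)
    define e' where "e' = e(d := (\<lambda>x. 1 / sqrt n * r x))"
    have e': "e' j = e j" if "j < d" for j using that by (simp add: e'_def)
    have e'd: "e' d = (\<lambda>x. 1 / sqrt n * r x)" by (simp add: e'_def)
    have unit: "(\<integral>x. e' d x * e' d x \<partial>M) = 1"
      using n by (simp add: e'd n_def[unfolded power2_eq_square, symmetric] mult.left_commute)
    have orth: "(\<integral>x. e' d x * e' j x \<partial>M) = 0" "(\<integral>x. e' j x * e' d x \<partial>M) = 0" if "j < d" for j
      using re[OF that] that by (simp_all add: e'd e' mult.commute mult.left_commute)
    have L2d: "e' d \<in> L2_space M"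
      unfolding e'd by (rule L2_space_cmult[OF r])
    have "orthonormal M e' (Suc d)"
      unfolding orthonormal_def
      using unit orth orthonormalD[OF o] L2d
      by (auto simp: less_Suc_eq e')
    moreover have "\<exists>c. AE x in M. \<phi> i x = (\<Sum>j<Suc d. c j * e' j x)" if "i < Suc D" for i
    proof (cases "i = D")
      case True
      have "\<phi> D x = (\<Sum>j<Suc d. (a(d := sqrt n)) j * e' j x)" for x
        using n by (simp add: e' e'd r_def)
      then show ?thesis unfolding True by (intro exI[of _ "a(d := sqrt n)"]) simp
    next
      case False
      with that obtain c where "AE x in M. \<phi> i x = (\<Sum>j<d. c j * e j x)"
        using span[of i] by auto
      then show ?thesis by (intro exI[of _ "c(d := 0)"]) (simp add: e')
    qed
    ultimately show ?thesis
      using d by (intro exI[of _ e'] exI[of _ "Suc d"]) auto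
  qed
qed

lemma L2_dim_orthonormal:
  assumes "L2_subspace M S" "L2_dim M S D"
  shows "\<exists>e d. d \<le> D \<and> orthonormal M e d \<and> (\<forall>f\<in>S. \<exists>c. AE x in M. f x = (\<Sum>j<d. c j * e j x))"
proof -
  obtain \<phi> where \<phi>: "\<And>i. i < D \<Longrightarrow> \<phi> i \<in> S"
    and span: "\<And>f. f \<in> S \<Longrightarrow> \<exists>c. AE x in M. f x = (\<Sum>i<D. c i * \<phi> i x)"
    using assms(2) unfolding L2_dim_def by blast
  have "\<phi> i \<in> L2_space M" if "i < D" for i
    using assms(1) \<phi>[OF that] by (auto simp: L2_subspace_def)
  then obtain e d where d: "d \<le> D" and o: "orthonormal M e d"
    and b: "\<And>i. i < D \<Longrightarrow> \<exists>c. AE x in M. \<phi> i x = (\<Sum>j<d. c j * e j x)"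
    using gram_schmidt[of D \<phi> M] by metis
  obtain b where b: "\<And>i. i < D \<Longrightarrow> AE x in M. \<phi> i x = (\<Sum>j<d. b i j * e j x)"
    using b by metis
  have "\<exists>c. AE x in M. f x = (\<Sum>j<d. c j * e j x)" if f: "f \<in> S" for f
  proof -
    obtain c where c: "AE x in M. f x = (\<Sum>i<D. c i * \<phi> i x)" using span[OF f] by auto
    have "AE x in M. \<forall>i\<in>{..<D}. \<phi> i x = (\<Sum>j<d. b i j * e j x)"
      using b by (intro AE_finite_allI) auto
    with c have "AE x in M. f x = (\<Sum>j<d. (\<Sum>i<D. c i * b i j) * e j x)"
    proof eventually_elim
      case (elim x)
      then have "f x = (\<Sum>i<D. \<Sum>j<d. c i * (b i j * e j x))"
        by (simp add: sum_distrib_left)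
      also have "\<dots> = (\<Sum>j<d. \<Sum>i<D. c i * (b i j * e j x))"
        by (rule sum.swap)
      finally show ?case by (simp add: sum_distrib_right mult.assoc)
    qed
    then show ?thesis by (rule exI[of _ "\<lambda>j. \<Sum>i<D. c i * b i j"])
  qed
  with d o show ?thesis by blast
qed

text \<open>
  Rounding each coordinate moves it by at most one.
\<close>

lemma lattice_approximation:
  assumes o: "orthonormal M e d" and f: "AE x in M. f x = (\<Sum>j<d. c j * e j x)"
    and fm: "f \<in> borel_measurable M"
  shows "\<exists>k\<in>PiE {..<d} (\<lambda>_. UNIV :: int set).
     (\<integral>x. (f x - (\<Sum>i<d. of_int (k i) * e i x))\<^sup>2 \<partial>M) \<le> real d"
proof
  let ?k = "restrict (\<lambda>i. round (c i)) {..<d}"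
  show "?k \<in> PiE {..<d} (\<lambda>_. UNIV)" by simp
  have "(\<integral>x. (f x - (\<Sum>i<d. of_int (?k i) * e i x))\<^sup>2 \<partial>M)
     = (\<integral>x. (\<Sum>i<d. (c i - of_int (?k i)) * e i x)\<^sup>2 \<partial>M)"
  proof (rule integral_cong_AE)
    show "AE x in M. (f x - (\<Sum>i<d. of_int (?k i) * e i x))\<^sup>2 = (\<Sum>i<d. (c i - of_int (?k i)) * e i x)\<^sup>2"
      using f by eventually_elim (simp add: left_diff_distrib sum_subtractf)
  qed (use fm L2_spaceD(1)[OF orthonormal_combination_L2[OF o]] in auto)
  also have "\<dots> = (\<Sum>i<d. (c i - of_int (?k i))\<^sup>2)"
    by (rule integral_combination_square[OF o])
  also have "\<dots> \<le> (\<Sum>i<d. 1)"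
  proof (rule sum_mono)
    fix i assume "i \<in> {..<d}"
    moreover have "\<bar>c i - of_int (round (c i))\<bar> \<le> 1"
      using of_int_round_abs_le[of "c i"] by linarith
    ultimately show "(c i - of_int (?k i))\<^sup>2 \<le> 1" by (simp add: abs_square_le_1)
  qed
  finally show "(\<integral>x. (f x - (\<Sum>i<d. of_int (?k i) * e i x))\<^sup>2 \<partial>M) \<le> real d" by simp
qed

lemma nn_integral_exp_abs_int_finite:
  "\<exists>K. (\<integral>\<^sup>+l. ennreal (exp (- \<bar>real_of_int l\<bar> / 32)) \<partial>count_space UNIV) \<le> ennreal K"
proof -
  let ?g = "\<lambda>l::int. ennreal (exp (- \<bar>real_of_int l\<bar> / 32))"
  define K where "K = 1 / (1 - exp (- 1 / 32 :: real))"
  have half: "(\<integral>\<^sup>+l. ?g l \<partial>count_space (range h)) = ennreal K"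
    if h: "inj h" "\<And>n. \<bar>real_of_int (h n)\<bar> = real n" for h :: "nat \<Rightarrow> int"
  proof -
    have "(\<integral>\<^sup>+l. ?g l \<partial>count_space (range h)) = (\<integral>\<^sup>+n. ?g (h n) \<partial>count_space UNIV)"
      using h by (intro nn_integral_bij_count_space[symmetric]) (auto simp: bij_betw_def)
    also have "\<dots> = (\<Sum>n. ennreal (exp (- 1 / 32) ^ n))"
      by (simp add: h nn_integral_count_space_nat flip: exp_of_nat_mult)
    also have "\<dots> = ennreal K"
      unfolding K_def by (intro suminf_ennreal_eq geometric_sums) auto
    finally show ?thesis .
  qed
  have "(\<integral>\<^sup>+l. ?g l \<partial>count_space UNIV) \<le>
      (\<integral>\<^sup>+l. ?g l * indicator (range int) l + ?g l * indicator (range (\<lambda>n. - int n)) l \<partial>count_space UNIV)"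
  proof (rule nn_integral_mono)
    fix l :: int
    have "l \<in> range int \<or> l \<in> range (\<lambda>n. - int n)"
      by (cases l rule: int_cases2) auto
    then show "?g l \<le> ?g l * indicator (range int) l + ?g l * indicator (range (\<lambda>n. - int n)) l"
      by (auto simp: indicator_def)
  qed
  also have "\<dots> = (\<integral>\<^sup>+l. ?g l \<partial>count_space (range int)) + (\<integral>\<^sup>+l. ?g l \<partial>count_space (range (\<lambda>n. - int n)))"
    by (subst nn_integral_add) (auto simp: nn_integral_count_space_indicator)
  also have "\<dots> = ennreal K + ennreal K"
    by (subst (1 2) half) (auto simp: inj_on_def)
  also have "\<dots> = ennreal (K + K)"
    by (simp add: K_def flip: ennreal_plus)
  finally show ?thesis by blast
qed

text \<open>
  Shifting the sum by the integer part of \<open>a\<close> leaves a remainder \<open>r \<in> [0, 1)\<close>, and \<open>(l - r)\<^sup>2 \<ge> \<bar>l\<bar>/2 - 1\<close>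
  for integers \<open>l\<close>, so that a geometric series bounds the sum uniformly in \<open>a\<close>.
\<close>

lemma gaussian_sum_int:
  "\<exists>K\<ge>1. \<forall>a::real. (\<integral>\<^sup>+k. ennreal (exp (- (real_of_int k - a)\<^sup>2 / 16)) \<partial>count_space UNIV) \<le> ennreal K"
proof -
  obtain K where K: "(\<integral>\<^sup>+l. ennreal (exp (- \<bar>real_of_int l\<bar> / 32)) \<partial>count_space UNIV) \<le> ennreal K"
    using nn_integral_exp_abs_int_finite by blast
  have "(\<integral>\<^sup>+k. ennreal (exp (- (real_of_int k - a)\<^sup>2 / 16)) \<partial>count_space UNIV)
      \<le> ennreal (max 1 (exp 1 * K))" for a :: real
  proof -
    have le: "exp (- (real_of_int (l + \<lfloor>a\<rfloor>) - a)\<^sup>2 / 16) \<le> exp 1 * exp (- \<bar>real_of_int l\<bar> / 32)" for l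
    proof -
      define y where "y = real_of_int (l + \<lfloor>a\<rfloor>) - a"
      define r where "r = a - \<lfloor>a\<rfloor>"
      have "0 \<le> r" "r \<le> 1" unfolding r_def by linarith+
      then have "r\<^sup>2 \<le> 1" by (simp add: power_le_one)
      moreover have "\<bar>real_of_int l\<bar> \<le> (real_of_int l)\<^sup>2"
      proof (cases "l = 0")
        case False
        then have "1 \<le> \<bar>real_of_int l\<bar>" by linarith
        then show ?thesis using self_le_power[of "\<bar>real_of_int l\<bar>" 2] by simp
      qed simp
      moreover have "(real_of_int l)\<^sup>2 \<le> 2 * y\<^sup>2 + 2 * r\<^sup>2"
        using sum_squares_bound[of y r] by (simp add: y_def r_def power2_eq_square algebra_simps)
      ultimately have "- y\<^sup>2 / 16 \<le> 1 - \<bar>real_of_int l\<bar> / 32" by (simp add: field_simps)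
      then show ?thesis by (simp add: y_def flip: exp_add)
    qed
    have "(\<integral>\<^sup>+k. ennreal (exp (- (real_of_int k - a)\<^sup>2 / 16)) \<partial>count_space UNIV)
       = (\<integral>\<^sup>+l. ennreal (exp (- (real_of_int (l + \<lfloor>a\<rfloor>) - a)\<^sup>2 / 16)) \<partial>count_space UNIV)"
      by (intro nn_integral_bij_count_space[symmetric] bij_betwI[of _ _ _ "\<lambda>l. l - \<lfloor>a\<rfloor>"]) auto
    also have "\<dots> \<le> (\<integral>\<^sup>+l. ennreal (exp 1) * ennreal (exp (- \<bar>real_of_int l\<bar> / 32)) \<partial>count_space UNIV)"
      using le by (intro nn_integral_mono) (simp flip: ennreal_mult)
    also have "\<dots> = ennreal (exp 1) * (\<integral>\<^sup>+l. ennreal (exp (- \<bar>real_of_int l\<bar> / 32)) \<partial>count_space UNIV)"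
      by (rule nn_integral_cmult) simp
    also have "\<dots> \<le> ennreal (exp 1) * ennreal K"
      using K by (rule mult_left_mono) simp
    also have "\<dots> \<le> ennreal (max 1 (exp 1 * K))"
      by (simp add: ennreal_leI flip: ennreal_mult')
    finally show ?thesis .
  qed
  then show ?thesis by (intro exI[of _ "max 1 (exp 1 * K)"]) auto
qed

text \<open>
  By Bessel's inequality each term is at most a product over the coordinates, and the sum of products over the
  lattice is the product of the one-dimensional sums.
\<close>

lemma gaussian_sum_lattice:
  assumes o: "orthonormal M e d" and f: "f \<in> L2_space M"
    and K: "\<And>a::real. (\<integral>\<^sup>+k. ennreal (exp (- (real_of_int k - a)\<^sup>2 / 16)) \<partial>count_space UNIV) \<le> ennreal K"
      "1 \<le> K"
  shows "(\<integral>\<^sup>+k. ennreal (exp (- (\<integral>x. (f x - (\<Sum>i<d. of_int (k i) * e i x))\<^sup>2 \<partial>M) / 16))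
     \<partial>count_space (PiE {..<d} (\<lambda>_. UNIV))) \<le> ennreal (K ^ d)"
proof -
  define a where "a i = (\<integral>x. f x * e i x \<partial>M)" for i
  interpret product_sigma_finite "\<lambda>_::nat. count_space (UNIV :: int set)"
    by (intro product_sigma_finite.intro sigma_finite_measure_count_space)
  have le: "exp (- (\<integral>x. (f x - (\<Sum>i<d. of_int (k i) * e i x))\<^sup>2 \<partial>M) / 16)
      \<le> (\<Prod>i<d. exp (- (real_of_int (k i) - a i)\<^sup>2 / 16))" for k :: "nat \<Rightarrow> int"
  proof -
    have "(\<Prod>i<d. exp (- (real_of_int (k i) - a i)\<^sup>2 / 16)) = exp (\<Sum>i<d. - (real_of_int (k i) - a i)\<^sup>2 / 16)"
      by (rule exp_sum[symmetric]) simp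
    also have "(\<Sum>i<d. - (real_of_int (k i) - a i)\<^sup>2 / 16) = - (\<Sum>i<d. (real_of_int (k i) - a i)\<^sup>2) / 16"
      by (simp only: sum_negf sum_divide_distrib[symmetric])
    finally show ?thesis
      using bessel_inequality[OF o f, of "\<lambda>i. of_int (k i)"] unfolding a_def by simp
  qed
  have "(\<integral>\<^sup>+k. ennreal (exp (- (\<integral>x. (f x - (\<Sum>i<d. of_int (k i) * e i x))\<^sup>2 \<partial>M) / 16))
     \<partial>count_space (PiE {..<d} (\<lambda>_. UNIV)))
     \<le> (\<integral>\<^sup>+k. (\<Prod>i<d. ennreal (exp (- (real_of_int (k i) - a i)\<^sup>2 / 16))) \<partial>count_space (PiE {..<d} (\<lambda>_. UNIV)))"
    using le by (intro nn_integral_mono) (simp add: prod_ennreal ennreal_leI)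
  also have "\<dots> = (\<integral>\<^sup>+k. (\<Prod>i<d. ennreal (exp (- (real_of_int (k i) - a i)\<^sup>2 / 16)))
      \<partial>PiM {..<d} (\<lambda>_. count_space UNIV))"
    by (subst count_space_PiM_finite) auto
  also have "\<dots> = (\<Prod>i<d. \<integral>\<^sup>+k. ennreal (exp (- (real_of_int k - a i)\<^sup>2 / 16)) \<partial>count_space UNIV)"
    by (rule product_nn_integral_prod) auto
  also have "\<dots> \<le> (\<Prod>i<d. ennreal K)"
    by (intro prod_mono_ennreal K)
  finally show ?thesis using K(2) by (simp add: ennreal_power)
qed

section \<open>Lattice candidates for a family of linear models\<close>

text \<open>
  Tonelli's theorem for sums over a dependent index set of arbitrary cardinality.
\<close>

lemma nn_integral_count_space_Sigma:
  fixes f :: "'a \<times> 'b \<Rightarrow> ennreal"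
  shows "(\<integral>\<^sup>+p. f p \<partial>count_space (Sigma A B)) = (\<integral>\<^sup>+a. \<integral>\<^sup>+b. f (a, b) \<partial>count_space (B a) \<partial>count_space A)"
proof -
  have ind: "indicator (Sigma A B) (a, b) = (indicator A a * indicator (B a) b :: ennreal)" for a b
    by (auto simp: indicator_def)
  have "(\<integral>\<^sup>+p. f p \<partial>count_space (Sigma A B))
      = (\<integral>\<^sup>+a. \<integral>\<^sup>+b. f (a, b) * indicator (Sigma A B) (a, b) \<partial>count_space UNIV \<partial>count_space UNIV)"
    by (subst nn_integral_fst_count_space) (simp add: nn_integral_count_space_indicator)
  also have "\<dots> = (\<integral>\<^sup>+a. (\<integral>\<^sup>+b. f (a, b) * indicator (B a) b \<partial>count_space UNIV) * indicator A a \<partial>count_space UNIV)"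
  proof (rule nn_integral_cong)
    fix a
    have "(\<integral>\<^sup>+b. f (a, b) * indicator (Sigma A B) (a, b) \<partial>count_space UNIV)
      = (\<integral>\<^sup>+b. f (a, b) * indicator (B a) b * indicator A a \<partial>count_space UNIV)"
      by (rule nn_integral_cong) (simp only: ind ac_simps)
    also have "\<dots> = (\<integral>\<^sup>+b. f (a, b) * indicator (B a) b \<partial>count_space UNIV) * indicator A a"
      by (rule nn_integral_multc) simp
    finally show "(\<integral>\<^sup>+b. f (a, b) * indicator (Sigma A B) (a, b) \<partial>count_space UNIV)
      = (\<integral>\<^sup>+b. f (a, b) * indicator (B a) b \<partial>count_space UNIV) * indicator A a" .
  qed
  also have "\<dots> = (\<integral>\<^sup>+a. \<integral>\<^sup>+b. f (a, b) \<partial>count_space (B a) \<partial>count_space A)"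
    by (simp add: nn_integral_count_space_indicator)
  finally show ?thesis .
qed

lemma nn_integral_count_space_infsum:
  fixes f :: "'b \<Rightarrow> real"
  assumes "f summable_on A" "\<And>x. x \<in> A \<Longrightarrow> 0 \<le> f x"
  shows "(\<integral>\<^sup>+x. ennreal (f x) \<partial>count_space A) = ennreal (infsum f A)"
proof -
  have "Infinite_Set_Sum.abs_summable_on f A"
    using assms(1) summable_on_iff_abs_summable_on_real[of f A] unfolding abs_summable_equivalent by (rule iffD1[rotated])
  then show ?thesis
    using assms(2) by (simp add: nn_integral_conv_infsetsum infsetsum_infsum)
qed

text \<open>
  For \<open>f \<ge> 0\<close>, passing to the positive part of \<open>u\<close> brings it closer to \<open>f\<close>; together with the negative part, the new
  distance still accounts for half of the squared distance from \<open>f\<close> to \<open>u\<close>.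
\<close>

lemma square_parts_le:
  fixes f u :: real
  assumes "0 \<le> f"
  shows "(f - u)\<^sup>2 / 2 \<le> (f - max 0 u)\<^sup>2 + (max 0 (- u))\<^sup>2"
    and "(f - max 0 u)\<^sup>2 \<le> (f - u)\<^sup>2" and "(max 0 (- u))\<^sup>2 \<le> (f - u)\<^sup>2"
proof -
  show "(f - u)\<^sup>2 / 2 \<le> (f - max 0 u)\<^sup>2 + (max 0 (- u))\<^sup>2"
  proof (cases "0 \<le> u")
    case False
    then show ?thesis using sum_squares_bound[of f "- u"] by (simp add: power2_eq_square algebra_simps)
  qed simp
  show "(f - max 0 u)\<^sup>2 \<le> (f - u)\<^sup>2" "(max 0 (- u))\<^sup>2 \<le> (f - u)\<^sup>2"
    using assms by (auto simp: abs_le_square_iff[symmetric])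
qed

text \<open>
  The negative part in the penalty turns distances of positive parts into distances of lattice points, at the
  price of a factor \<open>2\<close> in the exponent. The Gaussian sum is at most \<open>K\<^sup>d \<le> exp (P ln K)\<close>, and the
  multiple \<open>1 + ln K\<close> of \<open>P\<close> outweighs it with \<open>exp (- P)\<close> to spare.
\<close>

lemma nn_integral_positive_parts:
  assumes o: "orthonormal M e d" and f: "f \<in> L2_space M" "\<And>x. 0 \<le> f x"
    and K: "\<And>a::real. (\<integral>\<^sup>+k. ennreal (exp (- (real_of_int k - a)\<^sup>2 / 16)) \<partial>count_space UNIV) \<le> ennreal K"
      "1 \<le> K"
    and P: "real d \<le> P"
  shows "(\<integral>\<^sup>+k. ennreal (exp (- (\<integral>x. (f x - max 0 (\<Sum>i<d. of_int (k i) * e i x))\<^sup>2 \<partial>M) / 8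
        - ((1 + ln K) * P + (\<integral>x. (max 0 (- (\<Sum>i<d. of_int (k i) * e i x)))\<^sup>2 \<partial>M) / 8)))
     \<partial>count_space (PiE {..<d} (\<lambda>_. UNIV))) \<le> ennreal (exp (- P))"
proof -
  let ?c = "exp (- ((1 + ln K) * P))"
  define u where "u k x = (\<Sum>i<d. of_int (k i) * e i x)" for k :: "nat \<Rightarrow> int" and x
  have u: "u k \<in> L2_space M" for k unfolding u_def by (rule orthonormal_combination_L2[OF o])
  have le: "exp (- (\<integral>x. (f x - max 0 (u k x))\<^sup>2 \<partial>M) / 8 - ((1 + ln K) * P + (\<integral>x. (max 0 (- u k x))\<^sup>2 \<partial>M) / 8))
     \<le> ?c * exp (- (\<integral>x. (f x - u k x)\<^sup>2 \<partial>M) / 16)" for k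
  proof -
    have "(\<lambda>x. max 0 (u k x)) \<in> L2_space M" "(\<lambda>x. max 0 (- u k x)) \<in> L2_space M"
      using L2_spaceD(1)[OF u[of k]] by (intro L2_space_bound[OF u[of k]]; auto)+
    note i = L2_spaceD(2)[OF L2_space_diff[OF f(1) this(1)]] L2_spaceD(2)[OF this(2)]
      L2_spaceD(2)[OF L2_space_diff[OF f(1) u[of k]]]
    have "(\<integral>x. (f x - u k x)\<^sup>2 / 2 \<partial>M) \<le> (\<integral>x. (f x - max 0 (u k x))\<^sup>2 + (max 0 (- u k x))\<^sup>2 \<partial>M)"
      using i f by (intro integral_mono square_parts_le(1)) auto
    also have "\<dots> = (\<integral>x. (f x - max 0 (u k x))\<^sup>2 \<partial>M) + (\<integral>x. (max 0 (- u k x))\<^sup>2 \<partial>M)"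
      using i by simp
    finally show ?thesis by (simp flip: exp_add)
  qed
  have "(\<integral>\<^sup>+k. ennreal (exp (- (\<integral>x. (f x - max 0 (u k x))\<^sup>2 \<partial>M) / 8
      - ((1 + ln K) * P + (\<integral>x. (max 0 (- u k x))\<^sup>2 \<partial>M) / 8))) \<partial>count_space (PiE {..<d} (\<lambda>_. UNIV)))
    \<le> (\<integral>\<^sup>+k. ennreal ?c * ennreal (exp (- (\<integral>x. (f x - u k x)\<^sup>2 \<partial>M) / 16)) \<partial>count_space (PiE {..<d} (\<lambda>_. UNIV)))"
    using le by (intro nn_integral_mono) (simp add: ennreal_leI flip: ennreal_mult)
  also have "\<dots> = ennreal ?c * (\<integral>\<^sup>+k. ennreal (exp (- (\<integral>x. (f x - u k x)\<^sup>2 \<partial>M) / 16)) \<partial>count_space (PiE {..<d} (\<lambda>_. UNIV)))"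
    by (rule nn_integral_cmult) simp
  also have "\<dots> \<le> ennreal ?c * ennreal (K ^ d)"
    unfolding u_def by (intro mult_left_mono gaussian_sum_lattice o f K) simp
  also have "\<dots> = ennreal (?c * K ^ d)" using K by (simp add: ennreal_mult)
  also have "\<dots> \<le> ennreal (exp (- P))"
  proof (rule ennreal_leI)
    have "K ^ d = exp (real d * ln K)" using K by (simp add: exp_of_nat_mult)
    also have "\<dots> \<le> exp (P * ln K)" using P K by (simp add: mult_right_mono)
    finally have "?c * K ^ d \<le> ?c * exp (P * ln K)" by (intro mult_left_mono) auto
    also have "\<dots> = exp (- P)" by (simp add: algebra_simps flip: exp_add)
    finally show "?c * K ^ d \<le> exp (- P)" .
  qed
  finally show ?thesis unfolding u_def .
qed

text \<open>
  The models with a choice of orthonormal bases \<open>e m\<close> of size \<open>d m\<close>, and a bound \<open>K\<close> of the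
  one-dimensional Gaussian sums.
\<close>

locale model_family =
  fixes lam :: "'a measure" and I :: "'m set" and S :: "'m \<Rightarrow> ('a \<Rightarrow> real) set"
    and D :: "'m \<Rightarrow> nat" and \<Delta> :: "'m \<Rightarrow> real" and \<Sigma> K :: real
    and e :: "'m \<Rightarrow> nat \<Rightarrow> 'a \<Rightarrow> real" and d :: "'m \<Rightarrow> nat"
  assumes I: "countable I" "I \<noteq> {}"
    and S_L2: "\<And>m. m \<in> I \<Longrightarrow> S m \<subseteq> L2_space lam" and S_zero: "\<And>m. m \<in> I \<Longrightarrow> (\<lambda>_. 0) \<in> S m"
    and \<Delta>_D: "\<And>m. m \<in> I \<Longrightarrow> 1 \<le> max (real (D m)) (\<Delta> m)"
    and \<Sigma>: "(\<lambda>m. exp (- \<Delta> m)) summable_on I" "(\<Sum>\<^sub>\<infinity>m\<in>I. exp (- \<Delta> m)) \<le> \<Sigma>"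
    and K: "\<And>a::real. (\<integral>\<^sup>+k. ennreal (exp (- (real_of_int k - a)\<^sup>2 / 16)) \<partial>count_space UNIV) \<le> ennreal K"
      "1 \<le> K"
    and d: "\<And>m. m \<in> I \<Longrightarrow> d m \<le> D m"
    and e: "\<And>m. m \<in> I \<Longrightarrow> orthonormal lam (e m) (d m)"
    and span: "\<And>m f. m \<in> I \<Longrightarrow> f \<in> S m \<Longrightarrow> \<exists>c. AE x in lam. f x = (\<Sum>j<d m. c j * e m j x)"
begin

definition lattice :: "('m \<times> (nat \<Rightarrow> int)) set" where
  "lattice = (SIGMA m:I. PiE {..<d m} (\<lambda>_. UNIV))"

definition point :: "'m \<times> (nat \<Rightarrow> int) \<Rightarrow> 'a \<Rightarrow> real" where
  "point = (\<lambda>(m, k) x. \<Sum>i<d m. of_int (k i) * e m i x)"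

definition candidate :: "'m \<times> (nat \<Rightarrow> int) \<Rightarrow> 'a \<Rightarrow> real" where
  "candidate j x = max 0 (point j x)"

definition complexity :: "'m \<Rightarrow> real" where
  "complexity m = max (real (D m)) (\<Delta> m)"

definition penalty :: "'m \<times> (nat \<Rightarrow> int) \<Rightarrow> real" where
  "penalty j = (1 + ln K) * complexity (fst j) + (\<integral>x. (max 0 (- point j x))\<^sup>2 \<partial>lam) / 8"

lemma point_L2: "j \<in> lattice \<Longrightarrow> point j \<in> L2_space lam"
  by (auto simp: lattice_def point_def intro!: orthonormal_combination_L2 e)

lemma parts_L2:
  assumes "j \<in> lattice"
  shows "candidate j \<in> L2_space lam" "(\<lambda>x. max 0 (- point j x)) \<in> L2_space lam"
proof -
  have [measurable]: "point j \<in> borel_measurable lam"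
    using point_L2[OF assms] by (rule L2_spaceD)
  show "candidate j \<in> L2_space lam" "(\<lambda>x. max 0 (- point j x)) \<in> L2_space lam"
    unfolding candidate_def[abs_def] by (rule L2_space_bound[OF point_L2[OF assms]]; measurable; simp)+
qed

sublocale candidate_family lam lattice candidate penalty
proof
  show "countable lattice"
    unfolding lattice_def by (intro countable_SIGMA I countable_PiE) auto
  obtain m where "m \<in> I" using I by auto
  moreover have "restrict (\<lambda>_. 0) {..<d m} \<in> PiE {..<d m} (\<lambda>_. UNIV :: int set)" by simp
  ultimately show "lattice \<noteq> {}" unfolding lattice_def by blast
qed (auto simp: parts_L2 candidate_def)

lemma penalized_sum_le:
  assumes f: "f \<in> L2_space lam" "\<And>x. 0 \<le> f x"
  shows "(\<integral>\<^sup>+j. ennreal (exp (- (\<integral>x. (f x - candidate j x)\<^sup>2 \<partial>lam) / 8 - penalty j)) \<partial>count_space lattice)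
     \<le> ennreal \<Sigma>"
proof -
  have "(\<integral>\<^sup>+j. ennreal (exp (- (\<integral>x. (f x - candidate j x)\<^sup>2 \<partial>lam) / 8 - penalty j)) \<partial>count_space lattice)
    = (\<integral>\<^sup>+m. \<integral>\<^sup>+k. ennreal (exp (- (\<integral>x. (f x - candidate (m, k) x)\<^sup>2 \<partial>lam) / 8 - penalty (m, k)))
        \<partial>count_space (PiE {..<d m} (\<lambda>_. UNIV)) \<partial>count_space I)"
    unfolding lattice_def by (rule nn_integral_count_space_Sigma)
  also have "\<dots> \<le> (\<integral>\<^sup>+m. ennreal (exp (- \<Delta> m)) \<partial>count_space I)"
  proof (rule nn_integral_mono)
    fix m assume "m \<in> space (count_space I)"
    then have m: "m \<in> I" by simp
    have "real (d m) \<le> complexity m"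
      using d[OF m] by (auto simp: complexity_def)
    from nn_integral_positive_parts[OF e[OF m] f K this]
    have "(\<integral>\<^sup>+k. ennreal (exp (- (\<integral>x. (f x - candidate (m, k) x)\<^sup>2 \<partial>lam) / 8 - penalty (m, k)))
        \<partial>count_space (PiE {..<d m} (\<lambda>_. UNIV))) \<le> ennreal (exp (- complexity m))"
      by (simp add: candidate_def penalty_def point_def)
    also have "\<dots> \<le> ennreal (exp (- \<Delta> m))"
      by (intro ennreal_leI) (simp add: complexity_def)
    finally show "(\<integral>\<^sup>+k. ennreal (exp (- (\<integral>x. (f x - candidate (m, k) x)\<^sup>2 \<partial>lam) / 8 - penalty (m, k)))
        \<partial>count_space (PiE {..<d m} (\<lambda>_. UNIV))) \<le> ennreal (exp (- \<Delta> m))" .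
  qed
  also have "\<dots> = ennreal (\<Sum>\<^sub>\<infinity>m\<in>I. exp (- \<Delta> m))"
    using \<Sigma>(1) by (rule nn_integral_count_space_infsum) simp
  also have "\<dots> \<le> ennreal \<Sigma>" using \<Sigma>(2) by (rule ennreal_leI)
  finally show ?thesis .
qed

definition tradeoff :: "('a \<Rightarrow> real) \<Rightarrow> real" where
  "tradeoff s = (INF m\<in>I. (INF t\<in>S m. L2_norm lam (\<lambda>x. sqrt (s x) - t x))
      + sqrt (max (real (D m)) (\<Delta> m)))"

lemma tradeoff_ge_1: "1 \<le> tradeoff s"
  unfolding tradeoff_def
proof (rule cINF_greatest[OF I(2)])
  fix m assume m: "m \<in> I"
  have "0 \<le> (INF t\<in>S m. L2_norm lam (\<lambda>x. sqrt (s x) - t x))"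
    using S_zero[OF m] by (intro cINF_greatest) (auto simp: L2_norm_def)
  moreover have "1 \<le> sqrt (max (real (D m)) (\<Delta> m))" using \<Delta>_D[OF m] by simp
  ultimately show "1 \<le> (INF t\<in>S m. L2_norm lam (\<lambda>x. sqrt (s x) - t x)) + sqrt (max (real (D m)) (\<Delta> m))"
    by linarith
qed

lemma tradeoff_nearly_attained:
  obtains m t where "m \<in> I" "t \<in> S m"
    "L2_norm lam (\<lambda>x. sqrt (s x) - t x) + sqrt (complexity m) \<le> 2 * tradeoff s"
proof -
  let ?bias = "\<lambda>m. INF t\<in>S m. L2_norm lam (\<lambda>x. sqrt (s x) - t x)"
  have o: "1 \<le> tradeoff s" by (rule tradeoff_ge_1)
  have "tradeoff s < tradeoff s + 1 / 2" by simp
  then obtain m where m: "m \<in> I" "?bias m + sqrt (complexity m) < tradeoff s + 1 / 2"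
    using cInf_lessD[of "(\<lambda>m. ?bias m + sqrt (complexity m)) ` I" "tradeoff s + 1 / 2"] I(2)
    unfolding tradeoff_def complexity_def by auto
  have "S m \<noteq> {}" using S_zero[OF m(1)] by blast
  then obtain t where t: "t \<in> S m" "L2_norm lam (\<lambda>x. sqrt (s x) - t x) < ?bias m + 1 / 2"
    using cInf_lessD[of "(\<lambda>t. L2_norm lam (\<lambda>x. sqrt (s x) - t x)) ` S m" "?bias m + 1 / 2"] by auto
  show thesis using m t o by (intro that[of m t]) auto
qed

text \<open>
  Take a nearly optimal model and a nearly optimal function in it, and round the latter to a lattice point. Its
  positive part is at least as close to \<open>\<surd>s\<close> as the point itself, and its negative part, which enters the
  penalty, is at most as long as its distance to \<open>\<surd>s\<close>.
\<close>

lemma good_candidate: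
  assumes "mean_measure lam s N"
  defines "R \<equiv> sqrt (measure N (space N)) + tradeoff s"
  obtains i where "i \<in> lattice" "mean_measure.err lam s N (candidate i) \<le> (13 + 4 * ln K) * R\<^sup>2"
    "penalty i \<le> (13 + 4 * ln K) * R\<^sup>2"
proof -
  interpret mean_measure lam s N by fact
  obtain m t where m: "m \<in> I" and t: "t \<in> S m"
    and mt: "L2_norm lam (\<lambda>x. sqrt (s x) - t x) + sqrt (complexity m) \<le> 2 * tradeoff s"
    by (rule tradeoff_nearly_attained)
  have cm: "1 \<le> complexity m" using \<Delta>_D[OF m] by (simp add: complexity_def)
  have tL2: "t \<in> L2_space lam" using S_L2 m t by auto
  define \<epsilon> where "\<epsilon> = (\<integral>x. (sqrt (s x) - t x)\<^sup>2 \<partial>lam)"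
  define \<nu> where "\<nu> = measure N (space N)"
  have nn: "0 \<le> \<epsilon>" "0 \<le> \<nu>" by (simp_all add: \<epsilon>_def \<nu>_def)
  have "sqrt \<epsilon> + sqrt (complexity m) + sqrt \<nu> \<le> 2 * R"
    using mt real_sqrt_ge_zero[OF nn(2)] unfolding R_def \<epsilon>_def \<nu>_def L2_norm_def distrib_left by linarith
  then have "(sqrt \<epsilon> + sqrt (complexity m) + sqrt \<nu>)\<^sup>2 \<le> (2 * R)\<^sup>2"
    using nn cm by (intro power_mono) auto
  moreover have "\<epsilon> + complexity m + \<nu> \<le> (sqrt \<epsilon> + sqrt (complexity m) + sqrt \<nu>)\<^sup>2"
    using nn cm by (simp add: power2_sum)
  \<comment> \<open>The factor \<open>4\<close> is the square of the loss \<open>2\<close> in the choice of \<open>m\<close> and \<open>t\<close>.\<close>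
  ultimately have R: "\<epsilon> + complexity m + \<nu> \<le> 4 * R\<^sup>2" by (simp add: power_mult_distrib)
  obtain c where "AE x in lam. t x = (\<Sum>j<d m. c j * e m j x)" using span[OF m t] by auto
  then obtain k where k: "k \<in> PiE {..<d m} (\<lambda>_. UNIV)"
    and tk: "(\<integral>x. (t x - point (m, k) x)\<^sup>2 \<partial>lam) \<le> real (d m)"
    using lattice_approximation[OF e[OF m] _ L2_spaceD(1)[OF tL2]] by (auto simp: point_def)
  have i: "(m, k) \<in> lattice" using m k by (auto simp: lattice_def)
  let ?u = "point (m, k)"
  define \<eta> where "\<eta> = (\<integral>x. (sqrt (s x) - ?u x)\<^sup>2 \<partial>lam)"
  have L2: "(\<lambda>x. sqrt (s x) - t x) \<in> L2_space lam" "(\<lambda>x. t x - ?u x) \<in> L2_space lam"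
    "(\<lambda>x. sqrt (s x) - ?u x) \<in> L2_space lam" "(\<lambda>x. sqrt (s x) - candidate (m, k) x) \<in> L2_space lam"
    by (intro L2_space_diff sqrt_L1_nonneg s tL2 point_L2 parts_L2 i)+
  have "real (d m) \<le> complexity m" using d[OF m] by (auto simp: complexity_def)
  with integral_square_triangle[OF L2(1,2)] tk
  have \<eta>: "\<eta> \<le> 2 * \<epsilon> + 2 * complexity m" by (simp add: \<eta>_def \<epsilon>_def)
  have "(\<integral>x. (sqrt (s x) - candidate (m, k) x)\<^sup>2 \<partial>lam) \<le> \<eta>"
    unfolding \<eta>_def
  proof (rule integral_mono_AE[OF L2_spaceD(2)[OF L2(4)] L2_spaceD(2)[OF L2(3)]])
    show "AE x in lam. (sqrt (s x) - candidate (m, k) x)\<^sup>2 \<le> (sqrt (s x) - ?u x)\<^sup>2"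
      using s_nonneg by eventually_elim (simp add: candidate_def square_parts_le)
  qed
  moreover have "(\<integral>x. (max 0 (- ?u x))\<^sup>2 \<partial>lam) \<le> \<eta>"
    unfolding \<eta>_def
  proof (rule integral_mono_AE[OF L2_spaceD(2)[OF parts_L2(2)[OF i]] L2_spaceD(2)[OF L2(3)]])
    show "AE x in lam. (max 0 (- ?u x))\<^sup>2 \<le> (sqrt (s x) - ?u x)\<^sup>2"
      using s_nonneg by eventually_elim (simp add: square_parts_le)
  qed
  moreover have lnK: "0 \<le> ln K" using K(2) by simp
  moreover have "ln K * complexity m \<le> ln K * (4 * R\<^sup>2)"
    using lnK R nn by (intro mult_left_mono) auto
  moreover have "0 \<le> ln K * R\<^sup>2" using lnK by simp
  moreover have "(13 + 4 * ln K) * R\<^sup>2 = 13 * R\<^sup>2 + 4 * (ln K * R\<^sup>2)"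
    "(1 + ln K) * complexity m = complexity m + ln K * complexity m" "0 \<le> R\<^sup>2"
    by (simp_all add: algebra_simps)
  ultimately have "err (candidate (m, k)) \<le> (13 + 4 * ln K) * R\<^sup>2"
    "penalty (m, k) \<le> (13 + 4 * ln K) * R\<^sup>2"
    using \<eta> R nn cm unfolding err_def penalty_def \<nu>_def[symmetric] fst_conv by linarith+
  with i show thesis by (rule that)
qed

lemma selected_tradeoff_risk:
  assumes mm: "mean_measure lam s N" and "orthogonal_measures N lam" and q: "1 \<le> q"
  shows "(\<integral>\<^sup>+X. ennreal (hellinger (measure_add (weighted s lam) N)
        (weighted (\<lambda>x. (candidate (selected X) x)\<^sup>2) lam) powr q) \<partial>poisson_process (measure_add (weighted s lam) N))
     \<le> ennreal ((114 * q * (13 + 4 * ln K)) powr (q / 2) * (1 + \<Sigma>) *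
          (sqrt (measure N (space N)) + tradeoff s) powr q)"
proof -
  define R where "R = sqrt (measure N (space N)) + tradeoff s"
  have R: "1 \<le> R" using tradeoff_ge_1[of s] by (simp add: R_def add_increasing)
  define c where "c = 13 + 4 * ln K"
  have c: "1 \<le> c" using K(2) by (simp add: c_def)
  have cR: "1 \<le> c * R\<^sup>2" using c R by (metis mult_mono' mult_1 one_le_power zero_le_one)
  obtain i where i: "i \<in> lattice" "mean_measure.err lam s N (candidate i) \<le> c * R\<^sup>2" "penalty i \<le> c * R\<^sup>2"
    using good_candidate[OF mm] unfolding R_def c_def by blast
  have "0 \<le> (\<Sum>\<^sub>\<infinity>m\<in>I. exp (- \<Delta> m))" by (rule infsum_nonneg) simp
  then have \<Sigma>0: "0 \<le> \<Sigma>" using \<Sigma>(2) by linarith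
  have "(114 * q * (c * R\<^sup>2)) powr (q / 2) = (114 * q * c) powr (q / 2) * R powr q"
    using R by (simp add: powr_mult powr_powr flip: powr_numeral mult.assoc)
  then show ?thesis
    using selected_risk[OF mm assms(2) i(1) cR i(2,3) penalized_sum_le[OF t_L2[OF i(1)] t_nonneg] \<Sigma>0 q]
    by (simp add: R_def c_def mult_ac)
qed

end

theorem theorem1:
  shows "\<exists>C :: real \<Rightarrow> real.
    \<forall>(lam :: 'a measure) (I :: 'm set) (S :: 'm \<Rightarrow> ('a \<Rightarrow> real) set)
     (D :: 'm \<Rightarrow> nat) (\<Delta> :: 'm \<Rightarrow> real) (\<Sigma> :: real).
      countable I \<and> I \<noteq> {} \<and>
      (\<forall>m\<in>I. L2_subspace lam (S m) \<and> L2_dim lam (S m) (D m)) \<and>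
      (\<forall>m\<in>I. 0 \<le> \<Delta> m) \<and>
      (\<forall>m\<in>I. 1 \<le> max (real (D m)) (\<Delta> m)) \<and>
      (\<lambda>m. exp (- \<Delta> m)) summable_on I \<and> (\<Sum>\<^sub>\<infinity>m\<in>I. exp (- \<Delta> m)) \<le> \<Sigma>
      \<longrightarrow>
      (\<exists>s_hat. density_estimator lam s_hat \<and>
        (\<forall>\<mu> s \<mu>_perp q.
          \<mu> \<in> finite_measures lam \<and> s \<in> L1_nonneg lam \<and>
          \<mu>_perp \<in> finite_measures lam \<and> orthogonal_measures \<mu>_perp lam \<and>
          \<mu> = measure_add (weighted s lam) \<mu>_perp \<and> 1 \<le> q
          \<longrightarrow>
          (\<integral>\<^sup>+X. ennreal (hellinger \<mu> (weighted (s_hat X) lam) powr q) \<partial>poisson_process \<mu>)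
            \<le> ennreal (C q * (1 + \<Sigma>) *
                (sqrt (measure \<mu>_perp (space \<mu>_perp)) +
                 (INF m\<in>I. (INF t\<in>S m. L2_norm lam (\<lambda>x. sqrt (s x) - t x))
                            + sqrt (max (real (D m)) (\<Delta> m)))) powr q)))"
proof -
  obtain K where K: "1 \<le> K"
    "\<And>a::real. (\<integral>\<^sup>+k. ennreal (exp (- (real_of_int k - a)\<^sup>2 / 16)) \<partial>count_space UNIV) \<le> ennreal K"
    using gaussian_sum_int by blast
  show ?thesis
  proof (rule exI[of _ "\<lambda>q. (114 * q * (13 + 4 * ln K)) powr (q / 2)"], intro allI impI, elim conjE)
    fix lam :: "'a measure" and I :: "'m set" and S :: "'m \<Rightarrow> ('a \<Rightarrow> real) set"
      and D :: "'m \<Rightarrow> nat" and \<Delta> :: "'m \<Rightarrow> real" and \<Sigma> :: real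
    assume I: "countable I" "I \<noteq> {}"
      and S: "\<forall>m\<in>I. L2_subspace lam (S m) \<and> L2_dim lam (S m) (D m)"
      and \<Delta>: "\<forall>m\<in>I. 0 \<le> \<Delta> m" "\<forall>m\<in>I. 1 \<le> max (real (D m)) (\<Delta> m)"
      and \<Sigma>: "(\<lambda>m. exp (- \<Delta> m)) summable_on I" "(\<Sum>\<^sub>\<infinity>m\<in>I. exp (- \<Delta> m)) \<le> \<Sigma>"
    have "\<forall>m\<in>I. \<exists>e d. d \<le> D m \<and> orthonormal lam e d \<and>
        (\<forall>f\<in>S m. \<exists>c. AE x in lam. f x = (\<Sum>j<d. c j * e j x))"
      using S L2_dim_orthonormal by blast
    from bchoice[OF this] obtain e where "\<forall>m\<in>I. \<exists>d. d \<le> D m \<and> orthonormal lam (e m) d \<and>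
        (\<forall>f\<in>S m. \<exists>c. AE x in lam. f x = (\<Sum>j<d. c j * e m j x))" ..
    from bchoice[OF this] obtain d where ed: "\<forall>m\<in>I. d m \<le> D m \<and> orthonormal lam (e m) (d m) \<and>
        (\<forall>f\<in>S m. \<exists>c. AE x in lam. f x = (\<Sum>j<d m. c j * e m j x))" ..
    interpret model_family lam I S D \<Delta> \<Sigma> K e d
    proof
      show "S m \<subseteq> L2_space lam" "(\<lambda>_. 0) \<in> S m" if "m \<in> I" for m
        using S that by (auto simp: L2_subspace_def)
    qed (use I \<Delta> \<Sigma> K ed in auto)
    show "\<exists>s_hat. density_estimator lam s_hat \<and>
        (\<forall>\<mu> s \<mu>_perp q.
          \<mu> \<in> finite_measures lam \<and> s \<in> L1_nonneg lam \<and>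
          \<mu>_perp \<in> finite_measures lam \<and> orthogonal_measures \<mu>_perp lam \<and>
          \<mu> = measure_add (weighted s lam) \<mu>_perp \<and> 1 \<le> q
          \<longrightarrow>
          (\<integral>\<^sup>+X. ennreal (hellinger \<mu> (weighted (s_hat X) lam) powr q) \<partial>poisson_process \<mu>)
            \<le> ennreal ((114 * q * (13 + 4 * ln K)) powr (q / 2) * (1 + \<Sigma>) *
                (sqrt (measure \<mu>_perp (space \<mu>_perp)) +
                 (INF m\<in>I. (INF t\<in>S m. L2_norm lam (\<lambda>x. sqrt (s x) - t x))
                            + sqrt (max (real (D m)) (\<Delta> m)))) powr q))"
    proof (intro exI conjI allI impI, rule density_estimator_selected, elim conjE)
      fix \<mu> s \<mu>_perp and q :: real
      assume "s \<in> L1_nonneg lam" "\<mu>_perp \<in> finite_measures lam" "orthogonal_measures \<mu>_perp lam"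
        and \<mu>: "\<mu> = measure_add (weighted s lam) \<mu>_perp" and "1 \<le> q"
      then show "(\<integral>\<^sup>+X. ennreal (hellinger \<mu> (weighted (\<lambda>x. (candidate (selected X) x)\<^sup>2) lam) powr q)
            \<partial>poisson_process \<mu>)
          \<le> ennreal ((114 * q * (13 + 4 * ln K)) powr (q / 2) * (1 + \<Sigma>) *
                (sqrt (measure \<mu>_perp (space \<mu>_perp)) +
                 (INF m\<in>I. (INF t\<in>S m. L2_norm lam (\<lambda>x. sqrt (s x) - t x))
                            + sqrt (max (real (D m)) (\<Delta> m)))) powr q)"
        unfolding \<mu> tradeoff_def[symmetric]
        by (intro selected_tradeoff_risk mean_measure.intro)
    qed
  qed
qed

end
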